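(* Let $a(z)$ and $a_0(z)$ be rational functions with $a(z)\not\equiv 0$. Then the equation $$w(z+1)-w(z-1)+a(z)\frac{w'(z)}{w(z)}=a_0(z)$$ has no entire solutions $w(z)$ of infinite order with finite iterated order; that is, there is no entire solution $w$ with $\sigma(w)=\infty$ and $\sigma_i(w)<\infty$ for some integer $i\ge 2$.
   Context: All rational functions of $z$ are over $\mathbb{C}$; $a_0$ may be identically zero. For a meromorphic function $w$ in the complex plane with Nevanlinna characteristic $T(r,w)$, the order is $\sigma(w)=\limsup_{r\to\infty}\frac{\log T(r,w)}{\log r}$, and for $i=2,3,4,\dots$ the iterated $i$-order is $\sigma_i(w)=\limsup_{r\to\infty}\frac{\log_i T(r,w)}{\log r}$, where $\log_i$ denotes the $i$-fold iterated logarithm ($\log_1=\log$, $\log_{i+1}=\log\log_i$). A function of infinite order has finite iterated order if $\sigma_i(w)<\infty$ for some $i\ge 2$. A solution of the equation is a function satisfying it identically as an identity of meromorphic functions. *)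

theory Defs
  imports "HOL-Complex_Analysis.Complex_Analysis"
begin

(* Since x / 0 = 0, the functions below take the value 0 at the zeros of q; as meromorphic
   functions they are the elements of C(z), and the function is identically zero iff p = 0. *)
definition rational_function :: "(complex \<Rightarrow> complex) \<Rightarrow> bool" where
  "rational_function f \<longleftrightarrow>
     (\<exists>p q :: complex poly. q \<noteq> 0 \<and> f = (\<lambda>z. poly p z / poly q z))"

definition log_plus :: "real \<Rightarrow> real" where
  "log_plus x = max 0 (ln x)"

(* m(r,f) *)
definition proximity :: "(complex \<Rightarrow> complex) \<Rightarrow> real \<Rightarrow> real" where
  "proximity f r =
     1 / (2 * pi) * integral {0..2 * pi} (\<lambda>\<theta>. log_plus (norm (f (of_real r * cis \<theta>))))"

(* n(t,f): poles in the closed disc, counted with multiplicity;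
   at a pole, zorder is minus the multiplicity *)
definition pole_count :: "(complex \<Rightarrow> complex) \<Rightarrow> real \<Rightarrow> nat" where
  "pole_count f t = (\<Sum>z | norm z \<le> t \<and> is_pole f z. nat (- zorder f z))"

(* N(r,f) *)
definition integrated_pole_count :: "(complex \<Rightarrow> complex) \<Rightarrow> real \<Rightarrow> real" where
  "integrated_pole_count f r =
     integral {0..r} (\<lambda>t. (real (pole_count f t) - real (pole_count f 0)) / t)
     + real (pole_count f 0) * ln r"

(* T(r,f) *)
definition nevanlinna_char :: "(complex \<Rightarrow> complex) \<Rightarrow> real \<Rightarrow> real" where
  "nevanlinna_char f r = proximity f r + integrated_pole_count f r"

definition growth_order :: "(complex \<Rightarrow> complex) \<Rightarrow> ereal" where
  "growth_order f = Limsup at_top (\<lambda>r. ereal (ln (nevanlinna_char f r) / ln r))"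

(* For nonconstant meromorphic f, T(r,f) tends to infinity, so the i-fold iterated logarithm is
   a genuine one for all large r, and the totalised values of ln outside the positive reals
   do not influence the limit superior. *)
definition iterated_order :: "nat \<Rightarrow> (complex \<Rightarrow> complex) \<Rightarrow> ereal" where
  "iterated_order i f = Limsup at_top (\<lambda>r. ereal ((ln ^^ i) (nevanlinna_char f r) / ln r))"

(* The equation w(z+1) - w(z-1) + a(z) w'(z)/w(z) = a0(z) as an identity of meromorphic
   functions, i.e. off a set without limit points (zeros of w, poles of a and a0).  Dividing
   by w requires that w is not identically zero. *)
definition solves_equation ::
  "(complex \<Rightarrow> complex) \<Rightarrow> (complex \<Rightarrow> complex) \<Rightarrow> (complex \<Rightarrow> complex) \<Rightarrow> bool" where
  "solves_equation a a0 w \<longleftrightarrow>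
     \<not> (\<forall>\<^sub>\<approx>z\<in>UNIV. w z = 0) \<and>
     (\<forall>\<^sub>\<approx>z\<in>UNIV. w (z + 1) - w (z - 1) + a z * (deriv w z / w z) = a0 z)"

end

theory Submission
  imports Defs "HOL-Real_Asymp.Real_Asymp"
begin

text \<open>
  Clearing denominators, a zero of \<open>w\<close> of order \<open>m\<close> would make \<open>w'\<close> vanish to order \<open>m\<close> unless it
  is a root of a fixed polynomial, so \<open>w\<close> has finitely many zeros and \<open>w = P exp g\<close>, with \<open>g\<close> not a
  polynomial because \<open>w\<close> has infinite order. Let \<open>\<mu>\<close> be the maximum modulus of \<open>g\<close> and call an entire
  function tame if its maximum modulus at \<open>r\<close> is at most \<open>\<mu> (K r) ^ N\<close> for some \<open>K\<close> and \<open>N\<close>. The tame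
  functions contain \<open>g\<close> and all polynomials and are closed under sums, products, derivatives,
  shifts and entire quotients. The equation says that
  \<open>D (P(z + 1) exp (g (z + 1)) - P(z - 1) exp (g (z - 1))) = U + V g'\<close> with polynomials \<open>D\<close>, \<open>U\<close>, \<open>V\<close>,
  and differentiating it once shows that \<open>exp g\<close> is itself tame. By Borel-Caratheodory,
  \<open>\<mu> r \<le> C ln (\<mu> (K r))\<close>, so that \<open>i + 1\<close> steps \<open>r \<mapsto> K r\<close> make \<open>\<mu>\<close>, and with it \<open>T(r, w)\<close>, larger
  than any \<open>i\<close>-fold iterated exponential of \<open>C ln r\<close>.
\<close>

section \<open>Zeros and quotients of entire functions\<close>

text \<open>Near \<open>a\<close> the quotient is given by \<open>zor_poly\<close>, elsewhere by
  \<open>f z / (z - a) ^ m\<close>; the two agree on the overlap of the open sets, so they glue. The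
  case \<open>m = 0\<close> is included: \<open>a\<close> need not be a zero.\<close>

lemma holomorphic_divide_out_zero:
  assumes "f holomorphic_on A" "open A" "connected A" "a \<in> A" "\<exists>z\<in>A. f z \<noteq> 0"
  obtains m h where "h holomorphic_on A" "h a \<noteq> 0" "\<And>z. z \<in> A \<Longrightarrow> f z = (z - a) ^ m * h z"
proof -
  define m where "m = nat (zorder f a)"
  define g where "g = zor_poly f a"
  obtain r where r: "r > 0" "cball a r \<subseteq> A" "g holomorphic_on cball a r"
    "\<And>w. w \<in> cball a r \<Longrightarrow> f w = g w * (w - a) ^ m \<and> g w \<noteq> 0"
    using zorder_exist_zero[OF assms] unfolding m_def g_def by blast
  define h where "h z = (if z = a then g a else f z / (z - a) ^ m)" for z
  have h_eq: "h w = g w" if "w \<in> ball a r" for w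
    using r(4)[of w] that by (auto simp: h_def)
  have "h holomorphic_on ball a r \<union> (A - {a})"
  proof (rule holomorphic_on_Un)
    show "h holomorphic_on ball a r"
      using r(3) h_eq by (metis ball_subset_cball holomorphic_cong holomorphic_on_subset)
    have "(\<lambda>z. f z / (z - a) ^ m) holomorphic_on A - {a}"
      using assms(1) by (intro holomorphic_intros) (auto intro: holomorphic_on_subset)
    thus "h holomorphic_on A - {a}"
      by (rule holomorphic_transform) (auto simp: h_def)
  qed (use assms in auto)
  hence "h holomorphic_on A"
    by (rule holomorphic_on_subset) (use r in auto)
  moreover have "h a \<noteq> 0"
    using r(4)[of a] r(1) by (simp add: h_def)
  moreover have "f z = (z - a) ^ m * h z" if "z \<in> A" for z
    using r(4)[of a] r(1) by (simp add: h_def)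
  ultimately show thesis
    using that by blast
qed

lemma holomorphic_divide_out_zeros:
  assumes "f holomorphic_on A" "open A" "connected A" "\<exists>z\<in>A. f z \<noteq> 0" "finite Z" "Z \<subseteq> A"
  shows "\<exists>m h. h holomorphic_on A \<and> (\<forall>a\<in>Z. h a \<noteq> 0) \<and>
          (\<forall>z\<in>A. f z = (\<Prod>a\<in>Z. (z - a) ^ m a) * h z)"
  using \<open>finite Z\<close> \<open>Z \<subseteq> A\<close>
  proof (induction rule: finite_induct)
    case empty
    then show ?case using assms(1) by auto
  next
    case (insert b Z)
    then obtain m h where h: "h holomorphic_on A" "\<forall>a\<in>Z. h a \<noteq> 0"
      "\<forall>z\<in>A. f z = (\<Prod>a\<in>Z. (z - a) ^ m a) * h z"
      by auto
    have "\<exists>z\<in>A. h z \<noteq> 0"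
      using assms(4) h(3) by auto
    then obtain n k where k: "k holomorphic_on A" "k b \<noteq> 0"
      "\<And>z. z \<in> A \<Longrightarrow> h z = (z - b) ^ n * k z"
      using holomorphic_divide_out_zero[OF h(1) assms(2,3), of b] insert.prems by (metis insert_subset)
    define m' where "m' = m(b := n)"
    have "(\<Prod>a\<in>Z. (z - a) ^ m' a) = (\<Prod>a\<in>Z. (z - a) ^ m a)" for z
      using insert.hyps by (intro prod.cong) (auto simp: m'_def)
    hence "f z = (\<Prod>a\<in>insert b Z. (z - a) ^ m' a) * k z" if "z \<in> A" for z
      using that h(3) k(3) insert.hyps by (simp add: m'_def mult_ac)
    \<comment> \<open>At the earlier points \<open>k\<close> inherits nonvanishing from
      \<open>h\<close>, of which it is a factor.\<close>
    moreover have "\<forall>a\<in>insert b Z. k a \<noteq> 0"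
      using h(2) k(2,3) insert.prems by force
    ultimately show ?case
      using k(1) by blast
qed

text \<open>The Cayley transform \<open>u\<close> carries the right half-plane to the unit disc and
  \<open>k c\<close> to 0, so the Schwarz lemma gives modulus at most 1/2 on the half disc. Undoing
  the transform yields the factor 3 = (1 + 1/2) / (1 - 1/2).\<close>

lemma norm_le_of_Re_pos:
  fixes k :: "complex \<Rightarrow> complex"
  assumes "k holomorphic_on ball c R" "\<And>z. z \<in> ball c R \<Longrightarrow> Re (k z) > 0" "R > 0"
    and "dist c z \<le> R / 2"
  shows "norm (k z - \<i> * Im (k c)) \<le> 3 * Re (k c)"
proof -
  define k0 where "k0 = k c"
  have pos: "Re k0 > 0"
    using assms(2,3) by (simp add: k0_def)
  define \<phi> where "\<phi> w = (c + of_real R * w)" for w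
  define u where "u w = (k (\<phi> w) - k0) / (k (\<phi> w) + cnj k0)" for w
  have \<phi>: "\<phi> w \<in> ball c R" if "w \<in> ball 0 1" for w
    using that assms(3) by (simp add: \<phi>_def dist_norm norm_mult)
  have nz: "v + cnj k0 \<noteq> 0" if "Re v > 0" for v
    using that pos by (metis add_pos_pos cnj.simps(1) order_less_irrefl plus_complex.simps(1) zero_complex.simps(1))
  have *: "norm (v - k0) < norm (v + cnj k0)" if "Re v > 0" for v
  proof -
    have "norm (v + cnj k0) ^ 2 - norm (v - k0) ^ 2 = 4 * Re v * Re k0"
      unfolding cmod_power2 by (simp add: power2_eq_square algebra_simps)
    thus ?thesis
      using that pos by (smt (verit) mult_pos_pos norm_ge_zero power2_less_imp_less)
  qed
  have hol: "u holomorphic_on ball 0 1"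
  proof -
    have "(k \<circ> \<phi>) holomorphic_on ball 0 1"
      by (rule holomorphic_on_compose_gen[OF _ assms(1)])
         (use \<phi> in \<open>auto intro!: holomorphic_intros simp: \<phi>_def[abs_def] simp del: mem_ball\<close>)
    thus ?thesis
      using assms(2) \<phi> nz unfolding u_def o_def by (intro holomorphic_intros) auto
  qed
  define w where "w = (z - c) / of_real R"
  have w: "norm w \<le> 1/2" "\<phi> w = z"
    using assms(3,4) by (simp_all add: w_def \<phi>_def norm_divide dist_norm norm_minus_commute field_simps)
  have "norm (u w) \<le> norm w"
  proof (rule Schwarz_Lemma(1)[OF hol])
    show "norm (u v) < 1" if "norm v < 1" for v
      using *[of "k (\<phi> v)"] nz[of "k (\<phi> v)"] \<phi>[of v] assms(2)[of "\<phi> v"] that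
      by (simp add: u_def norm_divide)
  qed (use w in \<open>auto simp: u_def k0_def \<phi>_def\<close>)
  with w have uw: "norm (u w) \<le> 1/2" by simp
  have "z \<in> ball c R"
    using assms(3,4) by simp
  hence nz': "k z + cnj k0 \<noteq> 0"
    using nz assms(2) by blast
  \<comment> \<open>This inverts the Cayley transform; subtracting the imaginary part of
    \<open>k c\<close> leaves a real multiple of \<open>1 + u w\<close> on the right.\<close>
  have "(1 - u w) * (k z - \<i> * Im k0) = of_real (Re k0) * (1 + u w)"
  proof -
    have "u w * (k z + cnj k0) = k z - k0"
      using nz' w by (simp add: u_def)
    moreover have "(1 - u w) * (k z - \<i> * Im k0) =
        (k z - k0 - u w * (k z + cnj k0)) + (k0 - \<i> * Im k0) + u w * (cnj k0 + \<i> * Im k0)"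
      by (simp add: algebra_simps)
    moreover have "k0 - \<i> * Im k0 = Re k0" "cnj k0 + \<i> * Im k0 = Re k0"
      by (simp_all add: complex_eq_iff)
    ultimately show ?thesis
      by (simp add: algebra_simps)
  qed
  hence eq: "norm (1 - u w) * norm (k z - \<i> * Im k0) = Re k0 * norm (1 + u w)"
    using pos by (metis abs_of_pos norm_mult norm_of_real)
  have bounds: "norm (1 - u w) \<ge> 1/2" "norm (1 + u w) \<le> 3/2"
    using uw norm_triangle_ineq2[of 1 "u w"] norm_triangle_ineq[of 1 "u w"] by auto
  have "1/2 * norm (k z - \<i> * Im k0) \<le> norm (1 - u w) * norm (k z - \<i> * Im k0)"
    by (rule mult_right_mono[OF bounds(1)]) simp
  also have "\<dots> \<le> Re k0 * (3/2)"
    unfolding eq using bounds(2) pos by (intro mult_left_mono) auto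
  finally have "1/2 * norm (k z - \<i> * Im k0) \<le> Re k0 * (3/2)" .
  thus ?thesis
    by (simp add: k0_def)
qed

text \<open>The bound \<open>Re g < A\<close> says that \<open>A - g\<close> has positive real part,
  so \<open>norm_le_of_Re_pos\<close> applies to it.\<close>

lemma Borel_Caratheodory:
  fixes g :: "complex \<Rightarrow> complex"
  assumes "g holomorphic_on ball 0 R" "\<And>z. norm z < R \<Longrightarrow> Re (g z) < A" "R > 0" "norm z \<le> R / 2"
  shows "norm (g z) \<le> 4 * \<bar>A\<bar> + 4 * norm (g 0)"
proof -
  define y where "y = (of_real A - g z) - \<i> * Im (of_real A - g 0)"
  have "norm y \<le> 3 * Re (of_real A - g 0)"
    unfolding y_def
    by (rule norm_le_of_Re_pos[where R = R and k = "\<lambda>z. of_real A - g z" and c = 0])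
       (use assms in \<open>auto intro!: holomorphic_intros\<close>)
  moreover have "g z = of_real A - y + \<i> * Im (g 0)"
    by (simp add: y_def)
  hence "norm (g z) \<le> \<bar>A\<bar> + norm y + \<bar>Im (g 0)\<bar>"
    by (metis norm_triangle_le norm_triangle_ineq4 add_right_mono norm_of_real norm_mult norm_ii mult_1 order_trans)
  ultimately show ?thesis
    using abs_Re_le_cmod[of "g 0"] abs_Im_le_cmod[of "g 0"] by simp
qed

text \<open>On the circle \<open>R^2 = z * cnj z\<close>. Hence replacing a factor
  \<open>z - a\<close>, with \<open>a\<close> inside the disc, by
  \<open>(R^2 - cnj a * z) / R\<close> keeps its modulus there and removes its zero from the
  disc.\<close>

lemma norm_Blaschke_denominator:
  fixes z a :: complex
  assumes "norm z = R"
  shows "norm ((of_real R)^2 - cnj a * z) = R * norm (z - a)"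
proof -
  have "(of_real R)^2 = z * cnj z"
    using complex_norm_square[of z] assms by simp
  hence "(of_real R)^2 - cnj a * z = z * cnj (z - a)"
    by (simp add: algebra_simps)
  thus ?thesis
    by (simp only: norm_mult complex_mod_cnj assms)
qed

lemma norm_le_of_sphere:
  fixes f :: "complex \<Rightarrow> complex"
  assumes "f holomorphic_on UNIV" "\<And>z. norm z = R \<Longrightarrow> norm (f z) \<le> B" "norm z \<le> R"
  shows "norm (f z) \<le> B"
proof (rule maximum_modulus_frontier[of f "cball 0 R"])
  show "continuous_on (closure (cball 0 R)) f"
    by (rule holomorphic_on_imp_continuous_on[OF holomorphic_on_subset[OF assms(1) subset_UNIV]])
  show "f holomorphic_on interior (cball 0 R)"
    by (rule holomorphic_on_subset[OF assms(1) subset_UNIV])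
qed (use assms(2,3) in \<open>auto simp: frontier_cball\<close>)

text \<open>The difficulty is that \<open>G\<close> may be small near its zeros. Trading them for
  Blaschke denominators gives \<open>G1\<close>, zero-free in the open disc and of the same modulus
  as \<open>G\<close> on the circle. The maximum principle bounds \<open>G1 * H\<close> by
  \<open>A\<close>, and \<open>norm_le_of_Re_pos\<close> for a logarithm of \<open>G1\<close> bounds
  \<open>G1 z\<close> from below.\<close>

lemma entire_quotient_bound_0:
  fixes F G H :: "complex \<Rightarrow> complex"
  assumes "G holomorphic_on UNIV" "H holomorphic_on UNIV" "\<And>z. F z = G z * H z"
    and "G 0 \<noteq> 0" "R > 0"
    and "\<And>z. norm z \<le> R \<Longrightarrow> norm (F z) \<le> A" "\<And>z. norm z \<le> R \<Longrightarrow> norm (G z) \<le> B"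
    and "norm z \<le> R / 2"
  shows "norm (H z) \<le> A * (2 * B)^2 / norm (G 0) ^ 3"
proof -
  \<comment> \<open>These are the zeros in the open disc; the closed disc supplies the compactness
    that makes them finite in number. Zeros on the circle remain in \<open>h\<close>.\<close>
  define Z where "Z = {z \<in> cball 0 R. G z = 0} \<inter> ball 0 R"
  have B: "B > 0"
    using assms(4,5) assms(7)[of 0] by (metis less_eq_real_def less_le_trans norm_zero zero_less_norm_iff)
  have "finite Z"
  proof (cases "G constant_on UNIV")
    case True
    hence "Z = {}"
      using assms(4) by (auto simp: Z_def constant_on_def)
    thus ?thesis by simp
  next
    case False
    thus ?thesis
      unfolding Z_def
      by (intro finite_Int disjI1 holomorphic_compact_finite_zeros[OF assms(1)]) auto
  qed
  have "\<exists>z\<in>UNIV. G z \<noteq> 0"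
    using assms(4) by blast
  from holomorphic_divide_out_zeros[OF assms(1) open_UNIV connected_UNIV this \<open>finite Z\<close> subset_UNIV]
  obtain m h where h: "h holomorphic_on UNIV" "\<And>a. a \<in> Z \<Longrightarrow> h a \<noteq> 0"
    "\<And>z. G z = (\<Prod>a\<in>Z. (z - a) ^ m a) * h z"
    by blast
  define Q where "Q z = (\<Prod>a\<in>Z. (((of_real R)^2 - cnj a * z) / of_real R) ^ m a)" for z
  define G1 where "G1 z = Q z * h z" for z
  have holG1: "G1 holomorphic_on UNIV"
    unfolding G1_def Q_def using assms(5) h(1) by (intro holomorphic_intros) auto
  have Q_sphere: "norm (Q z) = norm (\<Prod>a\<in>Z. (z - a) ^ m a)" if "norm z = R" for z
    using that \<open>R > 0\<close>
    by (simp add: Q_def norm_Blaschke_denominator norm_power norm_divide flip: prod_norm)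
  have Q_nz: "Q z \<noteq> 0" if "norm z < R" for z
  proof -
    have "(of_real R)^2 - cnj a * z \<noteq> 0" if "a \<in> Z" for a
    proof
      assume "(of_real R)^2 - cnj a * z = 0"
      hence "norm (cnj a * z) = R^2"
        by (metis eq_iff_diff_eq_0 norm_of_real norm_power power2_abs)
      moreover have "norm (cnj a * z) < R * R"
        using that \<open>norm z < R\<close> unfolding norm_mult
        by (intro mult_strict_mono) (auto simp: Z_def intro: le_less_trans[OF norm_ge_zero])
      ultimately show False
        by (simp add: power2_eq_square)
    qed
    thus ?thesis
      using \<open>finite Z\<close> \<open>R > 0\<close> by (simp add: Q_def)
  qed
  have G1_nz: "G1 z \<noteq> 0" if "norm z < R" for z
  proof (cases "G z = 0")
    case True
    hence "z \<in> Z"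
      using that by (simp add: Z_def)
    thus ?thesis
      using h(2) Q_nz[OF that] by (simp add: G1_def)
  next
    case False
    thus ?thesis
      using h(3)[of z] Q_nz[OF that] by (auto simp: G1_def)
  qed
  have G1_le: "norm (G1 z) \<le> B" if "norm z \<le> R" for z
  proof (rule norm_le_of_sphere[OF holG1 _ that])
    show "norm (G1 z) \<le> B" if "norm z = R" for z
      using assms(7)[of z] that by (simp add: G1_def norm_mult Q_sphere h(3))
  qed
  have F1_le: "norm (G1 z * H z) \<le> A" if "norm z \<le> R" for z
  proof (rule norm_le_of_sphere[OF _ _ that])
    show "norm (G1 z * H z) \<le> A" if "norm z = R" for z
      using assms(6)[of z] that by (simp add: G1_def norm_mult Q_sphere h(3) assms(3))
  qed (intro holomorphic_intros holG1 assms)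
  \<comment> \<open>At the origin each new factor has modulus \<open>R\<close>, against
    \<open>norm a\<close> for the old one.\<close>
  have G1_0: "norm (G1 0) \<ge> norm (G 0)"
  proof -
    have "norm (\<Prod>a\<in>Z. (0 - a) ^ m a) \<le> norm (Q 0)"
      unfolding Q_def prod_norm[symmetric]
      using \<open>R > 0\<close>
      by (intro prod_mono) (auto simp: norm_power norm_divide power2_eq_square Z_def intro!: power_mono)
    thus ?thesis
      by (simp add: G1_def h(3) norm_mult mult_right_mono)
  qed
  obtain l where l: "l holomorphic_on ball 0 R" "\<And>z. z \<in> ball 0 R \<Longrightarrow> exp (l z) = G1 z"
    using holomorphic_logarithm_exists[of "ball 0 R" G1 0] holG1 G1_nz \<open>R > 0\<close>
    by (metis centre_in_ball convex_ball holomorphic_on_subset mem_ball_0 open_ball subset_UNIV)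
  \<comment> \<open>Taking \<open>2 * B\<close> instead of \<open>B\<close> makes the real part of
    \<open>k\<close> strictly positive.\<close>
  define k where "k z = of_real (ln (2 * B)) - l z" for z
  have Re_k: "Re (k z) = ln (2 * B) - ln (norm (G1 z))" if "norm z < R" for z
    using l(2)[of z, symmetric] that by (simp add: k_def)
  have zR: "norm z < R"
    using assms(5,8) by simp
  have "norm (k z - \<i> * Im (k 0)) \<le> 3 * Re (k 0)"
  proof (rule norm_le_of_Re_pos[where k = k and c = 0 and R = R])
    show "k holomorphic_on ball 0 R"
      unfolding k_def by (intro holomorphic_intros l)
    show "Re (k z) > 0" if "z \<in> ball 0 R" for z
    proof -
      have "norm (G1 z) < 2 * B" "norm (G1 z) > 0"
        using G1_le[of z] G1_nz[of z] that B by auto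
      hence "ln (norm (G1 z)) < ln (2 * B)"
        using B by simp
      thus ?thesis
        using Re_k[of z] that by simp
    qed
  qed (use assms in auto)
  hence "Re (k z) \<le> 3 * Re (k 0)"
    using complex_Re_le_cmod[of "k z - \<i> * Im (k 0)"] by simp
  hence "3 * ln (norm (G1 0)) \<le> 2 * ln (2 * B) + ln (norm (G1 z))"
    using Re_k[OF zR] Re_k[of 0] \<open>R > 0\<close> by simp
  moreover have "ln (norm (G 0)) \<le> ln (norm (G1 0))"
    using G1_0 assms(4) by (intro ln_mono) auto
  ultimately have "3 * ln (norm (G 0)) \<le> 2 * ln (2 * B) + ln (norm (G1 z))"
    by simp
  also have "2 * ln (2 * B) = ln ((2 * B)^2)"
    using ln_realpow[of "2 * B" 2] B by simp
  also have "\<dots> + ln (norm (G1 z)) = ln ((2 * B)^2 * norm (G1 z))"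
    using B G1_nz[OF zR] by (simp add: ln_mult)
  also have "3 * ln (norm (G 0)) = ln (norm (G 0) ^ 3)"
    using ln_realpow[of "norm (G 0)" 3] assms(4) by simp
  finally have *: "norm (G 0) ^ 3 \<le> (2 * B)^2 * norm (G1 z)"
    using B G1_nz[OF zR] assms(4) by (subst (asm) ln_le_cancel_iff) auto
  have "norm (G 0) ^ 3 * norm (H z) \<le> (2 * B)^2 * norm (G1 z) * norm (H z)"
    by (intro mult_right_mono *) auto
  also have "\<dots> \<le> (2 * B)^2 * A"
    using F1_le[of z] zR by (simp add: norm_mult mult.assoc mult_left_mono)
  finally show ?thesis
    using assms(4) by (simp add: field_simps)
qed

lemma holomorphic_on_shift:
  fixes f :: "complex \<Rightarrow> complex"
  assumes "f holomorphic_on UNIV"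
  shows "(\<lambda>z. f (z + c)) holomorphic_on A"
proof -
  have "(\<lambda>z. z + c) holomorphic_on A"
    by (intro holomorphic_intros)
  thus ?thesis
    using holomorphic_on_compose_gen[OF _ assms] by (auto simp: o_def)
qed

lemma entire_quotient_bound:
  fixes F G H :: "complex \<Rightarrow> complex"
  assumes "G holomorphic_on UNIV" "H holomorphic_on UNIV" "\<And>z. F z = G z * H z"
    and "G c \<noteq> 0" "R > 0"
    and "\<And>z. dist c z \<le> R \<Longrightarrow> norm (F z) \<le> A" "\<And>z. dist c z \<le> R \<Longrightarrow> norm (G z) \<le> B"
    and "dist c z \<le> R / 2"
  shows "norm (H z) \<le> A * (2 * B)^2 / norm (G c) ^ 3"
proof -
  have "norm (H ((z - c) + c)) \<le> A * (2 * B)^2 / norm (G (0 + c)) ^ 3"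
    by (rule entire_quotient_bound_0[of "\<lambda>z. G (z + c)" "\<lambda>z. H (z + c)" "\<lambda>z. F (z + c)" R])
       (use assms in \<open>auto intro: holomorphic_on_shift[OF assms(1)] holomorphic_on_shift[OF assms(2)] simp: dist_norm norm_minus_commute\<close>)
  thus ?thesis by simp
qed

section \<open>Functions of tame growth\<close>

text \<open>By isolation of zeros, both functions are nonzero throughout a punctured neighbourhood
  of 0.\<close>

lemma entire_nonzero_common:
  fixes F G :: "complex \<Rightarrow> complex"
  assumes "F holomorphic_on UNIV" "G holomorphic_on UNIV" "F a \<noteq> 0" "G b \<noteq> 0"
  obtains z where "F z \<noteq> 0" "G z \<noteq> 0"
proof -
  have "eventually (\<lambda>z. F z \<noteq> 0 \<and> z \<in> UNIV) (at 0)"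
    by (rule non_zero_neighbour_alt[where \<beta> = a]) (use assms in auto)
  moreover have "eventually (\<lambda>z. G z \<noteq> 0 \<and> z \<in> UNIV) (at 0)"
    by (rule non_zero_neighbour_alt[where \<beta> = b]) (use assms in auto)
  ultimately have "eventually (\<lambda>z. F z \<noteq> 0 \<and> G z \<noteq> 0) (at 0)"
    by eventually_elim auto
  from eventually_happens'[OF at_neq_bot this] show thesis
    using that by blast
qed

text \<open>On a ball without zeros of \<open>p * S\<close> the Wronskian is the numerator of the
  derivative of \<open>X / S\<close>, so the quotient is constant there; analytic continuation
  extends the relation to the plane.\<close>

lemma Wronskian_zero_imp_proportional:
  fixes p X S :: "complex \<Rightarrow> complex"
  assumes hol: "p holomorphic_on UNIV" "X holomorphic_on UNIV" "S holomorphic_on UNIV"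
    and nz: "p a \<noteq> 0" "S b \<noteq> 0"
    and W: "\<And>z. p z * (deriv X z * S z - X z * deriv S z) = 0"
  shows "\<exists>c. \<forall>z. X z = c * S z"
proof -
  obtain z0 where z0: "p z0 \<noteq> 0" "S z0 \<noteq> 0"
    using entire_nonzero_common[OF hol(1,3) nz] by blast
  have "open {z. p z * S z \<noteq> 0}"
    by (intro open_Collect_neq continuous_intros)
       (use hol in \<open>auto intro: holomorphic_on_imp_continuous_on\<close>)
  then obtain r where r: "r > 0" "ball z0 r \<subseteq> {z. p z * S z \<noteq> 0}"
    using z0 by (metis (mono_tags, lifting) mem_Collect_eq mult_eq_0_iff open_contains_ball)
  have pS: "p z \<noteq> 0" "S z \<noteq> 0" if "z \<in> ball z0 r" for z
    using r(2) that by auto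
  have "((\<lambda>z. X z / S z) has_field_derivative 0) (at z)" if "z \<in> ball z0 r" for z
  proof -
    have "((\<lambda>z. X z / S z) has_field_derivative
            (deriv X z * S z - X z * deriv S z) / (S z * S z)) (at z)"
      using hol pS[OF that] by (intro DERIV_divide holomorphic_derivI[of _ UNIV]) auto
    thus ?thesis
      using W[of z] pS[OF that] by simp
  qed
  then obtain c where c: "\<And>z. z \<in> ball z0 r \<Longrightarrow> X z / S z = c"
    using has_field_derivative_zero_constant[of "ball z0 r" "\<lambda>z. X z / S z"]
    by (metis DERIV_subset convex_ball subset_UNIV)
  have "X z = c * S z" for z
  proof (rule analytic_continuation_open[of "ball z0 r" UNIV X "\<lambda>z. c * S z"])
    show "X z = c * S z" if "z \<in> ball z0 r" for z
      using c[OF that] pS[OF that] by (simp add: field_simps)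
  qed (use hol r in \<open>auto intro!: holomorphic_intros\<close>)
  thus ?thesis
    by blast
qed

section \<open>Growth of polynomials and the maximum modulus\<close>

lemma poly_growth:
  fixes p :: "complex poly"
  shows "\<exists>m. eventually (\<lambda>r. \<forall>z. norm z \<le> r \<longrightarrow> norm (poly p z) \<le> r ^ m) at_top"
proof (induction p)
  case 0
  show ?case
    by (auto intro!: exI[of _ 0])
next
  case (pCons a p)
  then obtain m where m: "eventually (\<lambda>r. \<forall>z. norm z \<le> r \<longrightarrow> norm (poly p z) \<le> r ^ m) at_top"
    by blast
  \<comment> \<open>One extra power of \<open>r\<close> pays for the factor \<open>z\<close>, a
    second one for the constant 2, so that no constant remains in front of the power.\<close>
  have "eventually (\<lambda>r. \<forall>z. norm z \<le> r \<longrightarrow> norm (poly (pCons a p) z) \<le> r ^ (m + 2)) at_top"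
    using m eventually_ge_at_top[of 2] eventually_ge_at_top[of "norm a"]
  proof eventually_elim
    case (elim r)
    have "norm (poly (pCons a p) z) \<le> r ^ (m + 2)" if "norm z \<le> r" for z
    proof -
      have "norm (poly (pCons a p) z) \<le> norm a + norm z * norm (poly p z)"
        by (simp add: norm_triangle_mono norm_mult)
      also have "\<dots> \<le> r * r ^ m + r * r ^ m"
      proof (intro add_mono mult_mono)
        have "r \<le> r * r ^ m"
          using elim mult_left_mono[OF one_le_power[of r m], of r] by simp
        thus "norm a \<le> r * r ^ m"
          using elim by linarith
      qed (use elim that in auto)
      also have "\<dots> = 2 * r ^ (m + 1)"
        by simp
      also have "\<dots> \<le> r * r ^ (m + 1)"
        using elim by (intro mult_right_mono) auto
      finally show ?thesis by simp
    qed
    thus ?case by blast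
  qed
  thus ?case by blast
qed

lemma poly_bounded_below_at_infinity:
  fixes p :: "complex poly"
  assumes "p \<noteq> 0"
  shows "\<exists>d>0. \<exists>R. \<forall>z. norm z \<ge> R \<longrightarrow> norm (poly p z) \<ge> d"
  using assms
proof (induction p)
  case 0
  thus ?case by simp
next
  case (pCons a p)
  show ?case
  proof (cases "p = 0")
    case True
    thus ?thesis
      using pCons.hyps by (intro exI[of _ "norm a"]) auto
  next
    case False
    then obtain d R where dR: "d > 0" "\<forall>z. norm z \<ge> R \<longrightarrow> norm (poly p z) \<ge> d"
      using pCons.IH by blast
    \<comment> \<open>With this radius \<open>norm z * norm (poly p z)\<close> is at least
      \<open>d + norm a\<close>, which leaves \<open>d\<close> after the constant term is
      subtracted.\<close>
    have "norm (poly (pCons a p) z) \<ge> d" if "norm z \<ge> max R (1 + norm a / d)" for z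
    proof -
      have "(1 + norm a / d) * d \<le> norm z * norm (poly p z)"
        using that dR by (intro mult_mono) auto
      moreover have "(1 + norm a / d) * d = d + norm a"
        using dR(1) by (simp add: distrib_right)
      ultimately have "d + norm a \<le> norm (z * poly p z)"
        by (simp add: norm_mult)
      thus ?thesis
        using norm_triangle_ineq2[of "z * poly p z" "- a"] by (simp add: add.commute)
    qed
    with dR(1) show ?thesis
      by blast
  qed
qed

text \<open>The supremum is over the closed disc, not the circle, so monotonicity in
  \<open>r\<close> follows without the maximum principle. For negative \<open>r\<close> the disc is
  empty, hence the conditions \<open>r \<ge> 0\<close> below.\<close>

definition max_modulus :: "(complex \<Rightarrow> complex) \<Rightarrow> real \<Rightarrow> real" where
  "max_modulus f r = (SUP z\<in>cball 0 r. norm (f z))"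

lemma bdd_above_norm_cball:
  fixes f :: "complex \<Rightarrow> complex"
  assumes "f holomorphic_on UNIV"
  shows "bdd_above ((\<lambda>z. norm (f z)) ` cball 0 r)"
proof -
  have "compact ((\<lambda>z. norm (f z)) ` cball 0 r)"
    using holomorphic_on_imp_continuous_on[OF holomorphic_on_subset[OF assms subset_UNIV]]
    by (intro compact_continuous_image continuous_on_norm) auto
  thus ?thesis
    by (intro bounded_imp_bdd_above compact_imp_bounded)
qed

lemma norm_le_max_modulus:
  assumes "f holomorphic_on UNIV" "norm z \<le> r"
  shows "norm (f z) \<le> max_modulus f r"
  unfolding max_modulus_def
  by (rule cSUP_upper) (use assms bdd_above_norm_cball in auto)

lemma max_modulus_le:
  assumes "r \<ge> 0" "\<And>z. norm z \<le> r \<Longrightarrow> norm (f z) \<le> B"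
  shows "max_modulus f r \<le> B"
  unfolding max_modulus_def
  by (rule cSUP_least) (use assms in auto)

lemma max_modulus_mono:
  assumes "f holomorphic_on UNIV" "0 \<le> r" "r \<le> s"
  shows "max_modulus f r \<le> max_modulus f s"
  by (rule max_modulus_le) (use assms norm_le_max_modulus in auto)

text \<open>The exponent \<open>n = 0\<close> makes the maximum modulus eventually at least 1, so
  that its powers increase with the exponent; larger \<open>n\<close> let it absorb polynomial
  factors.\<close>

locale transcendental_entire =
  fixes g :: "complex \<Rightarrow> complex"
  assumes entire: "g holomorphic_on UNIV"
    and transcendental: "\<And>n. eventually (\<lambda>r. r ^ n \<le> max_modulus g r) at_top"
begin

abbreviation "\<mu> \<equiv> max_modulus g"

text \<open>The dilation \<open>K\<close> leaves room for shifts, Cauchy estimates and quotients,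
  the exponent \<open>N\<close> for products.\<close>

definition tame :: "(complex \<Rightarrow> complex) \<Rightarrow> bool" where
  "tame F \<longleftrightarrow> F holomorphic_on UNIV \<and>
     (\<exists>N K. K \<ge> 1 \<and> (\<forall>\<^sub>F r in at_top. \<forall>z. norm z \<le> r \<longrightarrow> norm (F z) \<le> \<mu> (K * r) ^ N))"

section \<open>Closure properties of tame functions\<close>

lemma tame_entire: "tame F \<Longrightarrow> F holomorphic_on UNIV"
  by (simp add: tame_def)

lemma power_max_modulus_mono:
  assumes "K \<ge> 1" "K' \<ge> K" "N' \<ge> N"
  shows "eventually (\<lambda>r. \<mu> (K * r) ^ N \<le> \<mu> (K' * r) ^ N') at_top"
  using transcendental[of 0] eventually_ge_at_top[of 0]
proof eventually_elim
  case (elim r)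
  have "1 * r \<le> K * r" "K * r \<le> K' * r"
    using assms elim by (intro mult_right_mono; simp)+
  hence mono: "\<mu> r \<le> \<mu> (K * r)" "\<mu> (K * r) \<le> \<mu> (K' * r)"
    using elim by (intro max_modulus_mono entire; simp)+
  hence "\<mu> (K * r) ^ N \<le> \<mu> (K' * r) ^ N"
    using elim by (intro power_mono) auto
  also have "\<dots> \<le> \<mu> (K' * r) ^ N'"
    using elim mono assms(3) by (intro power_increasing) auto
  finally show ?case .
qed

lemma tame_eventually_all:
  assumes "tame F"
  shows "\<exists>N0 K0. K0 \<ge> 1 \<and> (\<forall>N\<ge>N0. \<forall>K\<ge>K0.
     \<forall>\<^sub>F r in at_top. \<forall>z. norm z \<le> r \<longrightarrow> norm (F z) \<le> \<mu> (K * r) ^ N)"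
proof -
  obtain N0 K0 where *: "K0 \<ge> 1"
    "\<forall>\<^sub>F r in at_top. \<forall>z. norm z \<le> r \<longrightarrow> norm (F z) \<le> \<mu> (K0 * r) ^ N0"
    using assms unfolding tame_def by blast
  have "\<forall>\<^sub>F r in at_top. \<forall>z. norm z \<le> r \<longrightarrow> norm (F z) \<le> \<mu> (K * r) ^ N"
    if "N \<ge> N0" "K \<ge> K0" for N K
    using power_max_modulus_mono[OF *(1) that(2,1)] *(2)
    by eventually_elim (blast intro: order_trans)
  with *(1) show ?thesis
    by blast
qed

lemma tame_common:
  assumes "tame F" "tame G"
  obtains N K where "K \<ge> 1"
    "\<forall>\<^sub>F r in at_top. \<forall>z. norm z \<le> r \<longrightarrow> norm (F z) \<le> \<mu> (K * r) ^ N \<and> norm (G z) \<le> \<mu> (K * r) ^ N"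
proof -
  obtain N1 K1 where 1: "K1 \<ge> 1" "\<forall>N\<ge>N1. \<forall>K\<ge>K1.
     \<forall>\<^sub>F r in at_top. \<forall>z. norm z \<le> r \<longrightarrow> norm (F z) \<le> \<mu> (K * r) ^ N"
    using tame_eventually_all[OF assms(1)] by blast
  obtain N2 K2 where 2: "K2 \<ge> 1" "\<forall>N\<ge>N2. \<forall>K\<ge>K2.
     \<forall>\<^sub>F r in at_top. \<forall>z. norm z \<le> r \<longrightarrow> norm (G z) \<le> \<mu> (K * r) ^ N"
    using tame_eventually_all[OF assms(2)] by blast
  show thesis
  proof (rule that[of "max K1 K2" "max N1 N2"])
    show "\<forall>\<^sub>F r in at_top. \<forall>z. norm z \<le> r \<longrightarrow> norm (F z) \<le> \<mu> (max K1 K2 * r) ^ max N1 N2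
            \<and> norm (G z) \<le> \<mu> (max K1 K2 * r) ^ max N1 N2"
      using 1(2)[rule_format, OF max.cobounded1 max.cobounded1, of K2 N2]
        2(2)[rule_format, OF max.cobounded2 max.cobounded2, of K1 N1]
      by eventually_elim blast
  qed (use 1 in auto)
qed

text \<open>A factor \<open>r ^ m\<close> costs only one more power, since eventually
  \<open>r ^ m \<le> \<mu> r \<le> \<mu> (K * r)\<close>. All constants in the closure properties
  are paid for in this way.\<close>

lemma tameI:
  assumes "F holomorphic_on UNIV" "K \<ge> 1"
    and "\<forall>\<^sub>F r in at_top. \<forall>z. norm z \<le> r \<longrightarrow> norm (F z) \<le> r ^ m * \<mu> (K * r) ^ N"
  shows "tame F"
proof -
  have "\<forall>\<^sub>F r in at_top. \<forall>z. norm z \<le> r \<longrightarrow> norm (F z) \<le> \<mu> (K * r) ^ (N + 1)"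
    using assms(3) transcendental[of m] transcendental[of 0]
      power_max_modulus_mono[OF order_refl assms(2) order_refl[of 1]] eventually_ge_at_top[of 0]
  proof eventually_elim
    case (elim r)
    have "r ^ m * \<mu> (K * r) ^ N \<le> \<mu> (K * r) * \<mu> (K * r) ^ N"
      using elim assms(2) by (intro mult_right_mono zero_le_power) auto
    thus ?case
      using elim by (auto intro: order_trans)
  qed
  thus ?thesis
    using assms(1,2) unfolding tame_def by blast
qed

lemma tame_add:
  assumes "tame F" "tame G"
  shows "tame (\<lambda>z. F z + G z)"
proof -
  obtain N K where *: "K \<ge> 1" "\<forall>\<^sub>F r in at_top. \<forall>z. norm z \<le> r \<longrightarrow>
      norm (F z) \<le> \<mu> (K * r) ^ N \<and> norm (G z) \<le> \<mu> (K * r) ^ N"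
    using tame_common[OF assms] by blast
  show ?thesis
  proof (rule tameI[OF _ *(1)])
    show "\<forall>\<^sub>F r in at_top. \<forall>z. norm z \<le> r \<longrightarrow> norm (F z + G z) \<le> r ^ 1 * \<mu> (K * r) ^ N"
      using *(2) eventually_ge_at_top[of 2]
    proof eventually_elim
      case (elim r)
      have "norm (F z + G z) \<le> r ^ 1 * \<mu> (K * r) ^ N" if "norm z \<le> r" for z
      proof -
        have "norm (F z) \<le> \<mu> (K * r) ^ N" "norm (G z) \<le> \<mu> (K * r) ^ N"
          using elim that by auto
        \<comment> \<open>The factor 2 from the triangle inequality is absorbed by
          \<open>r \<ge> 2\<close>.\<close>
        moreover from this have "2 * \<mu> (K * r) ^ N \<le> r * \<mu> (K * r) ^ N"
          using elim by (intro mult_right_mono) (auto intro: order_trans[OF norm_ge_zero])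
        ultimately show ?thesis
          using norm_triangle_ineq[of "F z" "G z"] by simp
      qed
      thus ?case by blast
    qed
  qed (intro holomorphic_on_add assms[THEN tame_entire])
qed

lemma tame_mult:
  assumes "tame F" "tame G"
  shows "tame (\<lambda>z. F z * G z)"
proof -
  obtain N K where *: "K \<ge> 1" "\<forall>\<^sub>F r in at_top. \<forall>z. norm z \<le> r \<longrightarrow>
      norm (F z) \<le> \<mu> (K * r) ^ N \<and> norm (G z) \<le> \<mu> (K * r) ^ N"
    using tame_common[OF assms] by blast
  show ?thesis
  proof (rule tameI[OF _ *(1)])
    show "\<forall>\<^sub>F r in at_top. \<forall>z. norm z \<le> r \<longrightarrow> norm (F z * G z) \<le> r ^ 0 * \<mu> (K * r) ^ (N + N)"
      using *(2)
    proof eventually_elim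
      case (elim r)
      thus ?case
        unfolding norm_mult power_add
        by (auto intro!: mult_mono order_trans[OF norm_ge_zero])
    qed
  qed (intro holomorphic_on_mult assms[THEN tame_entire])
qed

lemma tame_poly: "tame (poly p)"
proof -
  obtain m where "eventually (\<lambda>r. \<forall>z. norm z \<le> r \<longrightarrow> norm (poly p z) \<le> r ^ m) at_top"
    using poly_growth by blast
  thus ?thesis
    by (intro tameI[of _ 1 m 0]) (auto intro!: holomorphic_intros)
qed

lemma tame_const: "tame (\<lambda>_. c)"
proof -
  have "poly [:c:] = (\<lambda>_. c)"
    by auto
  thus ?thesis
    using tame_poly by metis
qed

lemma tame_diff: "tame F \<Longrightarrow> tame G \<Longrightarrow> tame (\<lambda>z. F z - G z)"
  using tame_add[of F "\<lambda>z. (-1) * G z"] tame_mult[OF tame_const[of "-1"], of G] by simp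

lemma tame_self: "tame g"
  by (rule tameI[of _ 1 0 1]) (use entire norm_le_max_modulus in \<open>auto intro!: always_eventually\<close>)

lemma eventually_scaled:
  assumes "eventually P at_top" "c > (0::real)"
  shows "eventually (\<lambda>r. P (c * r)) at_top"
  using filterlim_tendsto_pos_mult_at_top[OF tendsto_const assms(2) filterlim_ident] assms(1)
  by (simp add: filterlim_iff)

lemma tame_shift:
  assumes "tame F"
  shows "tame (\<lambda>z. F (z + c))"
proof -
  obtain N K where *: "K \<ge> 1"
    "\<forall>\<^sub>F r in at_top. \<forall>z. norm z \<le> r \<longrightarrow> norm (F z) \<le> \<mu> (K * r) ^ N"
    using assms unfolding tame_def by blast
  show ?thesis
  \<comment> \<open>Once \<open>r \<ge> norm c\<close>, the shift stays in the disc of radius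
    \<open>2 * r\<close>, which doubles \<open>K\<close>.\<close>
  proof (rule tameI[of _ "2 * K" 0 N])
    show "\<forall>\<^sub>F r in at_top. \<forall>z. norm z \<le> r \<longrightarrow> norm (F (z + c)) \<le> r ^ 0 * \<mu> (2 * K * r) ^ N"
      using eventually_scaled[OF *(2), of 2, simplified] eventually_ge_at_top[of "norm c"]
    proof eventually_elim
      case (elim r)
      have "norm (F (z + c)) \<le> \<mu> (2 * K * r) ^ N" if "norm z \<le> r" for z
      proof -
        have "norm (z + c) \<le> 2 * r"
          using that elim norm_triangle_ineq[of z c] by linarith
        thus ?thesis
          using elim by (simp add: mult.left_commute mult.assoc)
      qed
      thus ?case by simp
    qed
  qed (use * tame_entire[OF assms] in \<open>auto intro: holomorphic_on_shift[OF tame_entire[OF assms]]\<close>)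
qed

text \<open>Cauchy's inequality on the unit circle about \<open>z\<close>, which lies in the disc of
  radius \<open>2 * r\<close> as soon as \<open>r \<ge> 1\<close>.\<close>

lemma tame_deriv:
  assumes "tame F"
  shows "tame (deriv F)"
proof -
  have hol: "F holomorphic_on A" for A
    using tame_entire[OF assms] holomorphic_on_subset by blast
  obtain N K where *: "K \<ge> 1"
    "\<forall>\<^sub>F r in at_top. \<forall>z. norm z \<le> r \<longrightarrow> norm (F z) \<le> \<mu> (K * r) ^ N"
    using assms unfolding tame_def by blast
  show ?thesis
  proof (rule tameI[of _ "2 * K" 0 N])
    show "\<forall>\<^sub>F r in at_top. \<forall>z. norm z \<le> r \<longrightarrow> norm (deriv F z) \<le> r ^ 0 * \<mu> (2 * K * r) ^ N"
      using eventually_scaled[OF *(2), of 2, simplified] eventually_ge_at_top[of 1]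
    proof eventually_elim
      case (elim r)
      have "norm (deriv F z) \<le> \<mu> (2 * K * r) ^ N" if "norm z \<le> r" for z
      proof -
        have "norm ((deriv ^^ 1) F z) \<le> fact 1 * \<mu> (2 * K * r) ^ N / 1 ^ 1"
        proof (rule Cauchy_inequality)
          fix x assume "norm (z - x) = 1"
          hence "norm x \<le> 2 * r"
            using that elim norm_triangle_ineq4[of z "z - x"] by simp
          thus "norm (F x) \<le> \<mu> (2 * K * r) ^ N"
            using elim by (simp add: mult.left_commute mult.assoc)
        qed (auto intro!: hol holomorphic_on_imp_continuous_on)
        thus ?thesis by simp
      qed
      thus ?case by simp
    qed
  qed (use * in \<open>auto intro!: holomorphic_intros hol\<close>)
qed

text \<open>The quotient is estimated around \<open>c\<close> because \<open>G 0\<close> may vanish.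
  The bound is cubic in the common bound of \<open>F\<close> and \<open>G\<close>, and its constant
  is absorbed by one factor \<open>r\<close>.\<close>

lemma tame_quotient:
  assumes "tame F" "tame G" "H holomorphic_on UNIV" "\<And>z. F z = G z * H z" "G c \<noteq> 0"
  shows "tame H"
proof -
  obtain N K where *: "K \<ge> 1" "\<forall>\<^sub>F r in at_top. \<forall>z. norm z \<le> r \<longrightarrow>
      norm (F z) \<le> \<mu> (K * r) ^ N \<and> norm (G z) \<le> \<mu> (K * r) ^ N"
    using tame_common[OF assms(1,2)] by blast
  show ?thesis
  proof (rule tameI[OF assms(3)])
    show "\<forall>\<^sub>F r in at_top. \<forall>z. norm z \<le> r \<longrightarrow> norm (H z) \<le> r ^ 1 * \<mu> (5 * K * r) ^ (3 * N)"
      using eventually_scaled[OF *(2), of 5, simplified] eventually_ge_at_top[of "norm c"]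
        eventually_gt_at_top[of 0] eventually_ge_at_top[of "4 / norm (G c) ^ 3"]
    proof eventually_elim
      case (elim r)
      define B where "B = \<mu> (5 * K * r) ^ N"
      have FG: "norm (F z) \<le> B" "norm (G z) \<le> B" if "norm z \<le> 5 * r" for z
        using elim that by (auto simp: B_def mult_ac)
      have "B \<ge> 0"
        using FG(1)[of 0] elim by (auto intro: order_trans[OF norm_ge_zero])
      have "norm (H z) \<le> r ^ 1 * \<mu> (5 * K * r) ^ (3 * N)" if "norm z \<le> r" for z
      proof -
        have "norm (H z) \<le> B * (2 * B)^2 / norm (G c) ^ 3"
        \<comment> \<open>For \<open>r \<ge> norm c\<close>, the disc of radius \<open>4 * r\<close>
          about \<open>c\<close> lies in the one of radius \<open>5 * r\<close> about 0, and its
          concentric half contains the disc of radius \<open>r\<close> about 0.\<close>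
        proof (rule entire_quotient_bound[where F = F and G = G and H = H and c = c and R = "4 * r"])
          show "norm (F x) \<le> B" "norm (G x) \<le> B" if "dist c x \<le> 4 * r" for x
            using that elim(2) norm_triangle_ineq2[of x c]
            by (auto intro!: FG simp: dist_norm norm_minus_commute)
          show "dist c z \<le> 4 * r / 2"
            using that elim(2) norm_triangle_ineq4[of c z] by (simp add: dist_norm)
        qed (use tame_entire[OF assms(2)] assms(3-5) elim in auto)
        also have "\<dots> = 4 / norm (G c) ^ 3 * B ^ 3"
          by (simp add: power2_eq_square power3_eq_cube)
        also have "\<dots> \<le> r * B ^ 3"
          using elim \<open>B \<ge> 0\<close> by (intro mult_right_mono) auto
        finally show ?thesis
          by (simp add: B_def mult.commute flip: power_mult)
      qed
      thus ?case by blast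
    qed
  qed (use * in auto)
qed

text \<open>This plays the role of Borel's theorem: \<open>S = X - Y\<close> and \<open>p S' = \<alpha> X - \<beta> Y\<close> are two linear
  equations for \<open>X\<close> and \<open>Y\<close>, whose determinant can vanish only if \<open>X\<close> is a multiple of \<open>S\<close>.\<close>
lemma tame_of_tame_difference:
  assumes "tame S" "tame p" "tame \<alpha>" "tame \<beta>" "X holomorphic_on UNIV" "Y holomorphic_on UNIV"
    and S: "\<And>z. S z = X z - Y z"
    and X: "\<And>z. p z * deriv X z = \<alpha> z * X z" and Y: "\<And>z. p z * deriv Y z = \<beta> z * Y z"
    and "p a \<noteq> 0" "S b \<noteq> 0"
  shows "tame X"
proof -
  have S': "deriv S z = deriv X z - deriv Y z" for z
    using assms(5,6) unfolding S[abs_def]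
    by (intro deriv_diff) (auto simp: holomorphic_on_def field_differentiable_at_within)
  show ?thesis
  proof (cases "\<forall>z. \<alpha> z = \<beta> z")
    case False
    then obtain c where c: "\<alpha> c - \<beta> c \<noteq> 0"
      by auto
    show ?thesis
    proof (rule tame_quotient[where c = c])
      show "p z * deriv S z - \<beta> z * S z = (\<alpha> z - \<beta> z) * X z" for z
        using X[of z] Y[of z] by (simp add: S S' algebra_simps)
    qed (intro tame_diff tame_mult tame_deriv assms(1-5) c)+
  next
    case True
    \<comment> \<open>Now \<open>S\<close> and \<open>X\<close> satisfy the same first-order linear
      equation, so their Wronskian vanishes wherever \<open>p\<close> does not.\<close>
    have "p z * (deriv X z * S z - X z * deriv S z) = 0" for z
    proof -
      have "p z * deriv S z = \<alpha> z * S z"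
        using X[of z] Y[of z] True by (simp add: S S' algebra_simps)
      moreover have "p z * (deriv X z * S z - X z * deriv S z) =
          (p z * deriv X z) * S z - X z * (p z * deriv S z)"
        by (simp add: algebra_simps)
      ultimately show ?thesis
        by (simp add: X)
    qed
    with Wronskian_zero_imp_proportional[OF assms(2)[THEN tame_entire] assms(5)
        assms(1)[THEN tame_entire] assms(10,11)]
    obtain c where "\<forall>z. X z = c * S z"
      by blast
    hence "X = (\<lambda>z. c * S z)"
      by auto
    thus ?thesis
      using tame_mult[OF tame_const assms(1)] by simp
  qed
qed

text \<open>Tameness bounds \<open>Re g\<close> by a multiple of
  \<open>ln (\<mu> (2 * K * r))\<close> on the disc of radius \<open>2 * r\<close>;
  Borel-Caratheodory turns this into a bound for \<open>g\<close> on the disc of radius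
  \<open>r\<close>.\<close>

lemma tame_exp_imp_log_bound:
  assumes "tame (\<lambda>z. exp (g z))"
  obtains C K where "C > 0" "K \<ge> 1" "\<forall>\<^sub>F r in at_top. \<mu> r \<le> C * ln (\<mu> (K * r))"
proof -
  obtain N K where *: "K \<ge> 1"
    "\<forall>\<^sub>F r in at_top. \<forall>z. norm z \<le> r \<longrightarrow> norm (exp (g z)) \<le> \<mu> (K * r) ^ N"
    using assms unfolding tame_def by blast
  \<comment> \<open>\<open>D\<close> collects the additive constants of
    \<open>Borel_Caratheodory\<close>; it is eventually below \<open>ln (\<mu> (2 * K * r))\<close>,
    whence the coefficient \<open>4 * N + 1\<close>.\<close>
  define D where "D = 4 + 4 * norm (g 0)"
  have "\<forall>\<^sub>F r in at_top. exp D \<le> \<mu> r"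
    using transcendental[of 1] eventually_ge_at_top[of "exp D"] by eventually_elim auto
  hence "\<forall>\<^sub>F r in at_top. exp D \<le> \<mu> (2 * K * r)"
    using *(1) by (intro eventually_scaled) auto
  with eventually_scaled[OF *(2), of 2, simplified] eventually_gt_at_top[of 0]
  have "\<forall>\<^sub>F r in at_top. \<mu> r \<le> (4 * real N + 1) * ln (\<mu> (2 * K * r))"
  proof eventually_elim
    case (elim r)
    define M where "M = \<mu> (2 * K * r)"
    have M: "M > 0" "D \<le> ln M"
      using elim less_le_trans[OF exp_gt_zero, of D M] by (auto simp: M_def ln_ge_iff)
    \<comment> \<open>The summand 1 provides the strict inequality that
      \<open>Borel_Caratheodory\<close> asks for.\<close>
    have "Re (g z) < real N * ln M + 1" if "norm z < 2 * r" for z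
    proof -
      have "exp (Re (g z)) \<le> M ^ N"
        using elim that by (auto simp: M_def mult_ac)
      hence "Re (g z) \<le> ln (M ^ N)"
        using M by (simp add: ln_ge_iff)
      thus ?thesis
        using M by (simp add: ln_realpow)
    qed
    moreover have "D \<ge> 0"
      by (simp add: D_def)
    ultimately have "norm (g z) \<le> 4 * \<bar>real N * ln M + 1\<bar> + 4 * norm (g 0)" if "norm z \<le> r" for z
      by (intro Borel_Caratheodory[where R = "2 * r"])
         (use that elim entire in \<open>auto intro: holomorphic_on_subset\<close>)
    hence "\<mu> r \<le> 4 * \<bar>real N * ln M + 1\<bar> + 4 * norm (g 0)"
      using elim by (intro max_modulus_le) auto
    also have "\<dots> = 4 * real N * ln M + D"
    proof -
      have "ln M \<ge> 0"
        using M \<open>D \<ge> 0\<close> by linarith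
      hence "real N * ln M \<ge> 0"
        by (rule mult_nonneg_nonneg[OF of_nat_0_le_iff])
      thus ?thesis
        by (simp add: D_def)
    qed
    also have "\<dots> \<le> (4 * real N + 1) * ln M"
      using M by (simp add: algebra_simps)
    finally show ?case
      by (simp add: M_def)
  qed
  thus thesis
    using that[of "4 * real N + 1" "2 * K"] *(1) by simp
qed

end

section \<open>The Nevanlinna characteristic of an entire function\<close>

text \<open>Cauchy's formula written in the angle. At \<open>z = 0\<close> the kernel is 1 and it
  becomes the mean value property.\<close>

lemma has_integral_Cauchy_circle:
  assumes "continuous_on (cball 0 r) \<phi>" "\<phi> holomorphic_on ball 0 r" "norm z < r"
  shows "((\<lambda>\<theta>. \<phi> (of_real r * cis \<theta>) * (of_real r * cis \<theta> / (of_real r * cis \<theta> - z)))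
           has_integral 2 * of_real pi * \<phi> z) {0..2 * pi}"
proof -
  have "((\<lambda>u. \<phi> u / (u - z)) has_contour_integral 2 * of_real pi * \<i> * \<phi> z) (part_circlepath 0 r 0 (2 * pi))"
    using Cauchy_integral_circlepath[OF assms(1,2), of z] assms(3) by (simp add: circlepath_def)
  hence "((\<lambda>t. \<phi> (0 + of_real r * cis t) / (0 + of_real r * cis t - z) * of_real r * \<i> * cis t)
            has_integral 2 * of_real pi * \<i> * \<phi> z) {0..2 * pi}"
    by (subst (asm) has_contour_integral_part_circlepath_iff) simp_all
  from has_integral_mult_right[OF this, of "-\<i>"] show ?thesis
    by (simp add: field_simps)
qed

text \<open>Adding the Cauchy formula for \<open>g\<close> at \<open>z\<close> and the conjugate of the mean value formula for
  \<open>\<zeta> \<mapsto> g \<zeta> r\<^sup>2 / (r\<^sup>2 - cnj z \<zeta>)\<close> leaves only \<open>Re g\<close> under the integral sign.\<close>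
lemma has_integral_Schwarz_formula:
  assumes "g holomorphic_on UNIV" "norm z < r"
  shows "((\<lambda>\<theta>. of_real (2 * Re (g (of_real r * cis \<theta>))) * (of_real r * cis \<theta> / (of_real r * cis \<theta> - z)))
           has_integral 2 * of_real pi * (g z + cnj (g 0))) {0..2 * pi}"
proof -
  have r: "r > 0"
    using assms(2) by (auto intro: le_less_trans[OF norm_ge_zero])
  define \<phi> where "\<phi> u = g u * ((of_real r)^2 / ((of_real r)^2 - cnj z * u))" for u
  \<comment> \<open>The only possible pole of \<phi> is the reflection of \<open>z\<close> in the
    circle, which lies outside the closed disc.\<close>
  have nz: "(of_real r)^2 - cnj z * u \<noteq> 0" if "norm u \<le> r" for u
  proof
    assume "(of_real r)^2 - cnj z * u = 0"
    hence "norm (cnj z * u) = r^2"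
      by (metis eq_iff_diff_eq_0 norm_of_real norm_power power2_abs)
    moreover have "norm (cnj z * u) \<le> norm z * r"
      using that unfolding norm_mult by (simp add: mult_left_mono)
    moreover have "norm z * r < r * r"
      using assms(2) r by simp
    ultimately show False
      by (simp add: power2_eq_square)
  qed
  have hol: "\<phi> holomorphic_on ball 0 r"
    unfolding \<phi>_def using nz assms(1)
    by (intro holomorphic_intros) (auto intro: holomorphic_on_subset)
  have cont: "continuous_on (cball 0 r) \<phi>"
    unfolding \<phi>_def using nz assms(1)
    by (intro continuous_intros) (auto intro: holomorphic_on_imp_continuous_on holomorphic_on_subset)
  have "((\<lambda>\<theta>. \<phi> (of_real r * cis \<theta>)) has_integral 2 * of_real pi * g 0) {0..2 * pi}"
    using has_integral_Cauchy_circle[OF cont hol, of 0] r by (simp add: \<phi>_def)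
  hence "((\<lambda>\<theta>. cnj (\<phi> (of_real r * cis \<theta>))) has_integral 2 * of_real pi * cnj (g 0)) {0..2 * pi}"
    by (subst (asm) has_integral_cnj[symmetric]) (simp add: o_def)
  moreover have "((\<lambda>\<theta>. g (of_real r * cis \<theta>) * (of_real r * cis \<theta> / (of_real r * cis \<theta> - z)))
           has_integral 2 * of_real pi * g z) {0..2 * pi}"
    by (rule has_integral_Cauchy_circle)
       (use assms in \<open>auto intro: holomorphic_on_imp_continuous_on holomorphic_on_subset\<close>)
  ultimately have "((\<lambda>\<theta>. g (of_real r * cis \<theta>) * (of_real r * cis \<theta> / (of_real r * cis \<theta> - z))
      + cnj (\<phi> (of_real r * cis \<theta>))) has_integral 2 * of_real pi * g z + 2 * of_real pi * cnj (g 0)) {0..2 * pi}"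
    by (intro has_integral_add)
  \<comment> \<open>On the circle \<open>r^2 = u * cnj u\<close>, so the conjugate of the factor in
    \<phi> is again the Cauchy kernel \<open>u / (u - z)\<close>.\<close>
  moreover have "g u * (u / (u - z)) + cnj (\<phi> u) = of_real (2 * Re (g u)) * (u / (u - z))"
    if u: "norm u = r" for u
  proof -
    have "cnj ((of_real r)^2) = u * cnj u"
      using complex_norm_square[of u] u by simp
    hence "cnj ((of_real r)^2 / ((of_real r)^2 - cnj z * u)) = (u * cnj u) / (u * cnj u - z * cnj u)"
      by (simp add: mult.commute)
    also have "\<dots> = u / (u - z)"
      using u r by (auto simp flip: left_diff_distrib)
    finally have "cnj (\<phi> u) = cnj (g u) * (u / (u - z))"
      by (simp only: \<phi>_def complex_cnj_mult)
    moreover have "g u + cnj (g u) = of_real (2 * Re (g u))"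
      by (rule complex_add_cnj)
    ultimately show ?thesis
      by (metis distrib_right)
  qed
  ultimately show ?thesis
    using r by (simp add: norm_mult distrib_left)
qed

text \<open>For \<open>norm z \<le> r / 2\<close> the Cauchy kernel is at most 2, so the Schwarz
  formula bounds \<open>g\<close> by the mean of \<open>\<bar>Re g\<bar>\<close>. Writing
  \<open>\<bar>u\<bar> = 2 * max 0 u - u\<close> leaves the positive part, as the mean of
  \<open>Re g\<close> is \<open>Re (g 0)\<close>.\<close>

lemma norm_le_integral_Re:
  assumes "g holomorphic_on UNIV" "r > 0" "norm z \<le> r / 2"
  shows "norm (g z) \<le> 5 * norm (g 0) +
           4 / pi * integral {0..2 * pi} (\<lambda>\<theta>. max 0 (Re (g (of_real r * cis \<theta>))))"
proof -
  define u where "u \<theta> = Re (g (of_real r * cis \<theta>))" for \<theta>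
  have contg: "continuous_on A g" for A
    using assms(1) holomorphic_on_imp_continuous_on holomorphic_on_subset by blast
  have contu: "continuous_on A u" for A
    unfolding u_def
    by (intro continuous_intros continuous_on_compose2[OF contg[of UNIV]]) auto
  have int: "v integrable_on {0..2 * pi}" if "continuous_on {0..2*pi} v" for v :: "real \<Rightarrow> real"
    using that by (rule integrable_continuous_real)
  have half: "norm u / 2 \<le> norm (u - z)" if "norm u = r" for u
    using norm_triangle_ineq2[of u z] assms(3) that by simp
  have zr: "norm z < r"
    using assms(2,3) by simp
  let ?I = "\<lambda>\<theta>. of_real (2 * Re (g (of_real r * cis \<theta>))) * (of_real r * cis \<theta> / (of_real r * cis \<theta> - z))"
  have "norm (2 * of_real pi * (g z + cnj (g 0))) \<le> integral {0..2 * pi} (\<lambda>\<theta>. 4 * \<bar>u \<theta>\<bar>)"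
    unfolding integral_unique[OF has_integral_Schwarz_formula[OF assms(1) zr], symmetric]
  proof (rule integral_norm_bound_integral)
    show "?I integrable_on {0..2 * pi}"
      using has_integral_Schwarz_formula[OF assms(1) zr] by blast
    show "(\<lambda>\<theta>. 4 * \<bar>u \<theta>\<bar>) integrable_on {0..2 * pi}"
      by (intro int continuous_intros contu)
    fix \<theta>
    define v where "v = of_real r * cis \<theta>"
    have "norm v = r"
      using assms(2) by (simp add: v_def norm_mult)
    hence "norm v / norm (v - z) \<le> 2"
      using half[of v] assms(2) by (simp add: divide_le_eq)
    hence "2 * \<bar>Re (g v)\<bar> * (norm v / norm (v - z)) \<le> 2 * \<bar>Re (g v)\<bar> * 2"
      by (intro mult_left_mono) auto
    thus "norm (?I \<theta>) \<le> 4 * \<bar>u \<theta>\<bar>"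
      by (simp add: v_def u_def norm_mult norm_divide)
  qed
  also have "\<dots> = 4 * integral {0..2 * pi} (\<lambda>\<theta>. 2 * max 0 (u \<theta>) - u \<theta>)"
    unfolding integral_mult_right by (intro arg_cong[where f = "\<lambda>x. 4 * x"] integral_cong) auto
  also have "integral {0..2 * pi} (\<lambda>\<theta>. 2 * max 0 (u \<theta>) - u \<theta>) =
      2 * integral {0..2 * pi} (\<lambda>\<theta>. max 0 (u \<theta>)) - integral {0..2 * pi} u"
    unfolding integral_mult_right[symmetric]
    by (intro integral_diff int continuous_intros contu)
  also have "integral {0..2 * pi} u = 2 * pi * Re (g 0)"
  proof -
    have "((\<lambda>\<theta>. g (of_real r * cis \<theta>)) has_integral 2 * of_real pi * g 0) {0..2 * pi}"
      using has_integral_Cauchy_circle[of r g 0] assms contg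
      by (auto intro: holomorphic_on_subset)
    from has_integral_Re[OF this] show ?thesis
      by (simp add: u_def[abs_def] o_def integral_unique)
  qed
  finally have "2 * pi * norm (g z + cnj (g 0)) \<le>
      4 * (2 * integral {0..2 * pi} (\<lambda>\<theta>. max 0 (u \<theta>)) - 2 * pi * Re (g 0))"
    by (simp add: norm_mult)
  hence "norm (g z + cnj (g 0)) \<le> 4 / pi * integral {0..2 * pi} (\<lambda>\<theta>. max 0 (u \<theta>)) - 4 * Re (g 0)"
    by (simp add: field_simps)
  moreover have "norm (g z) \<le> norm (g z + cnj (g 0)) + norm (g 0)"
    using norm_triangle_ineq4[of "g z + cnj (g 0)" "cnj (g 0)"] by simp
  ultimately show ?thesis
    using abs_Re_le_cmod[of "g 0"] by (simp add: u_def)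
qed

text \<open>At 0 the default \<open>ln 0 = 0\<close> gives the right value. With the maximum inside
  the logarithm the integrand is visibly continuous, also at zeros of the function.\<close>

lemma log_plus_eq: "x \<ge> 0 \<Longrightarrow> log_plus x = ln (max 1 x)"
  unfolding log_plus_def by (cases "x = 0") (auto simp: max_def)

lemma nevanlinna_char_entire:
  assumes "w holomorphic_on UNIV"
  shows "nevanlinna_char w r = 1 / (2 * pi) * integral {0..2 * pi} (\<lambda>\<theta>. ln (max 1 (norm (w (of_real r * cis \<theta>)))))"
proof -
  have "\<not> is_pole w z" for z
    by (rule not_is_pole_holomorphic[of UNIV]) (use assms in auto)
  hence "pole_count w t = 0" for t
    by (simp add: pole_count_def)
  thus ?thesis
    by (simp add: nevanlinna_char_def integrated_pole_count_def proximity_def log_plus_eq)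
qed

lemma continuous_on_log_max_norm_circle:
  assumes "w holomorphic_on UNIV"
  shows "continuous_on A (\<lambda>\<theta>. ln (max 1 (norm (w (of_real r * cis \<theta>)))))"
proof -
  have "continuous_on UNIV w"
    using assms by (rule holomorphic_on_imp_continuous_on)
  hence "continuous_on A (\<lambda>\<theta>. w (of_real r * cis \<theta>))"
    by (rule continuous_on_compose2) (auto intro!: continuous_intros)
  thus ?thesis
    by (intro continuous_intros continuous_on_max) (auto simp: max_def)
qed

lemma nevanlinna_char_le:
  assumes "w holomorphic_on UNIV" "r \<ge> 0" "\<And>z. norm z \<le> r \<Longrightarrow> norm (w z) \<le> exp B" "B \<ge> 0"
  shows "nevanlinna_char w r \<le> B"
proof -
  have "integral {0..2 * pi} (\<lambda>\<theta>. ln (max 1 (norm (w (of_real r * cis \<theta>))))) \<le>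
          integral {0..2 * pi} (\<lambda>\<theta>. B)"
  proof (rule integral_le)
    show "ln (max 1 (norm (w (of_real r * cis \<theta>)))) \<le> B" for \<theta>
    proof -
      have "max 1 (norm (w (of_real r * cis \<theta>))) \<le> exp B"
        using assms(2,4) assms(3)[of "of_real r * cis \<theta>"] by (simp add: norm_mult)
      thus ?thesis
        by (subst ln_exp[of B, symmetric], intro ln_mono) auto
    qed
  qed (intro integrable_continuous_real continuous_on_log_max_norm_circle assms continuous_intros)+
  thus ?thesis
    by (simp add: nevanlinna_char_entire[OF assms(1)] field_simps)
qed

lemma nevanlinna_char_nonneg:
  assumes "w holomorphic_on UNIV"
  shows "nevanlinna_char w r \<ge> 0"
proof -
  have "integral {0..2 * pi} (\<lambda>\<theta>. ln (max 1 (norm (w (of_real r * cis \<theta>))))) \<ge> 0"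
    by (rule integral_nonneg)
       (intro integrable_continuous_real continuous_on_log_max_norm_circle assms, auto)
  thus ?thesis
    by (simp add: nevanlinna_char_entire[OF assms])
qed

text \<open>On large circles the polynomial is at least \<open>d\<close> in modulus, so the positive
  part of \<open>Re g\<close> exceeds the integrand of the characteristic by at most
  \<open>\<bar>ln d\<bar>\<close>. The factor 8 is \<open>4 / pi\<close> times
  \<open>2 * pi\<close>.\<close>

lemma max_modulus_le_nevanlinna_char:
  assumes "g holomorphic_on UNIV" "p \<noteq> 0"
  shows "\<exists>B. \<forall>\<^sub>F r in at_top. max_modulus g r \<le> 8 * nevanlinna_char (\<lambda>z. poly p z * exp (g z)) (2 * r) + B"
proof -
  define w where "w z = poly p z * exp (g z)" for z
  have holw: "w holomorphic_on UNIV"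
    unfolding w_def by (intro holomorphic_intros assms)
  obtain d R where d: "d > 0" "\<And>z. norm z \<ge> R \<Longrightarrow> norm (poly p z) \<ge> d"
    using poly_bounded_below_at_infinity[OF assms(2)] by blast
  have contg: "continuous_on UNIV g"
    using assms(1) by (rule holomorphic_on_imp_continuous_on)
  have contu: "continuous_on A (\<lambda>\<theta>. Re (g (of_real r * cis \<theta>)))" for A r
    by (intro continuous_intros continuous_on_compose2[OF contg]) auto
  have *: "max_modulus g r \<le> 8 * nevanlinna_char w (2 * r) + (5 * norm (g 0) + 8 * \<bar>ln d\<bar>)"
    if r: "r > 0" "2 * r \<ge> R" for r
  proof -
    have "integral {0..2 * pi} (\<lambda>\<theta>. max 0 (Re (g (of_real (2 * r) * cis \<theta>)))) \<le>
       integral {0..2 * pi} (\<lambda>\<theta>. ln (max 1 (norm (w (of_real (2 * r) * cis \<theta>)))) + \<bar>ln d\<bar>)"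
    proof (rule integral_le)
      fix \<theta>
      define v where "v = of_real (2 * r) * cis \<theta>"
      have "norm v = 2 * r"
        using r by (simp add: v_def norm_mult)
      hence "d * exp (Re (g v)) \<le> norm (w v)"
        using d(2)[of v] r by (simp add: w_def norm_mult)
      hence "ln (d * exp (Re (g v))) \<le> ln (max 1 (norm (w v)))"
        using d(1) by (intro ln_mono) auto
      moreover have "ln (d * exp (Re (g v))) = ln d + Re (g v)"
        using d(1) by (simp add: ln_mult)
      moreover have "ln (max 1 (norm (w v))) \<ge> 0"
        by simp
      ultimately show "max 0 (Re (g (of_real (2 * r) * cis \<theta>))) \<le>
          ln (max 1 (norm (w (of_real (2 * r) * cis \<theta>)))) + \<bar>ln d\<bar>"
        unfolding v_def by linarith
    qed (intro integrable_continuous_real continuous_on_log_max_norm_circle holw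
           continuous_on_add continuous_on_const continuous_on_max contu)+
    also have "\<dots> = 2 * pi * nevanlinna_char w (2 * r) + 2 * pi * \<bar>ln d\<bar>"
    proof -
      have "integral {0..2 * pi} (\<lambda>\<theta>. ln (max 1 (norm (w (of_real (2 * r) * cis \<theta>)))) + \<bar>ln d\<bar>) =
          integral {0..2 * pi} (\<lambda>\<theta>. ln (max 1 (norm (w (of_real (2 * r) * cis \<theta>))))) +
          integral {0..2 * pi} (\<lambda>\<theta>. \<bar>ln d\<bar>)"
        by (intro integral_add integrable_continuous_real
              continuous_on_log_max_norm_circle[OF holw] continuous_on_const)
      thus ?thesis
        by (simp add: nevanlinna_char_entire[OF holw])
    qed
    finally have "4 / pi * integral {0..2 * pi} (\<lambda>\<theta>. max 0 (Re (g (of_real (2 * r) * cis \<theta>)))) \<le>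
        4 / pi * (2 * pi * nevanlinna_char w (2 * r) + 2 * pi * \<bar>ln d\<bar>)"
      by (intro mult_left_mono) auto
    also have "4 / pi * (2 * pi * nevanlinna_char w (2 * r) + 2 * pi * \<bar>ln d\<bar>) =
        8 * nevanlinna_char w (2 * r) + 8 * \<bar>ln d\<bar>"
      by (simp add: field_simps)
    finally have "norm (g z) \<le> 8 * nevanlinna_char w (2 * r) + (5 * norm (g 0) + 8 * \<bar>ln d\<bar>)"
      if "norm z \<le> r" for z
      using norm_le_integral_Re[OF assms(1), of "2 * r" z] r(1) that by linarith
    thus ?thesis
      using r by (intro max_modulus_le) auto
  qed
  have "\<forall>\<^sub>F r in at_top. max_modulus g r \<le> 8 * nevanlinna_char w (2 * r) + (5 * norm (g 0) + 8 * \<bar>ln d\<bar>)"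
    using eventually_gt_at_top[of 0] eventually_ge_at_top[of "R / 2"]
    by eventually_elim (use * in auto)
  thus ?thesis
    unfolding w_def[abs_def] by blast
qed

text \<open>At each stage \<open>y\<close> dominates an exponential, so every logarithm is taken of
  a positive number and default values of \<open>ln\<close> do not arise.\<close>

lemma iterated_ln_ge:
  assumes "(exp ^^ i) x \<le> (y::real)"
  shows "x \<le> (ln ^^ i) y"
  using assms
proof (induction i arbitrary: y)
  case (Suc i)
  have "exp ((exp ^^ i) x) \<le> y"
    using Suc.prems by simp
  hence "(exp ^^ i) x \<le> ln y"
    by (meson exp_gt_zero less_le_trans ln_ge_iff)
  from Suc.IH[OF this] show ?case
    by (simp add: funpow_Suc_right del: funpow.simps)
qed simp

section \<open>Solutions of the equation\<close>

lemma eventually_entire_zero_imp_zero: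
  fixes F :: "complex \<Rightarrow> complex"
  assumes "F holomorphic_on UNIV" "eventually (\<lambda>z. F z = 0) (at a)"
  shows "F z = 0"
proof (rule ccontr)
  assume "F z \<noteq> 0"
  hence "eventually (\<lambda>z. F z \<noteq> 0 \<and> z \<in> UNIV) (at a)"
    by (intro non_zero_neighbour_alt[where \<beta> = z]) (use assms in auto)
  with assms(2) have "eventually (\<lambda>_. False) (at a)"
    by eventually_elim auto
  thus False
    by simp
qed

lemma eventually_poly_nonzero:
  fixes p :: "complex poly"
  assumes "p \<noteq> 0"
  shows "eventually (\<lambda>z. poly p z \<noteq> 0) (at a)"
proof -
  obtain b where "poly p b \<noteq> 0"
    using assms poly_all_0_iff_0 by blast
  hence "eventually (\<lambda>z. poly p z \<noteq> 0 \<and> z \<in> UNIV) (at a)"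
    by (intro non_zero_neighbour_alt[where \<beta> = b]) (auto intro!: holomorphic_intros)
  thus ?thesis
    by eventually_elim auto
qed

text \<open>Off a sparse set the equation may be multiplied by \<open>q * q0 * w\<close>. The result
  is an identity of entire functions in a punctured neighbourhood of 0, hence everywhere.\<close>

lemma poly_differential_equation:
  assumes w: "w holomorphic_on UNIV" and q: "q \<noteq> 0" "q0 \<noteq> 0"
    and eq: "solves_equation (\<lambda>z. poly p z / poly q z) (\<lambda>z. poly p0 z / poly q0 z) w"
  shows "(w (z + 1) - w (z - 1)) * poly (q * q0) z * w z + poly (p * q0) z * deriv w z = poly (p0 * q) z * w z"
    and "\<exists>z. w z \<noteq> 0"
proof -
  have ev: "\<forall>\<^sub>\<approx>z\<in>UNIV. w (z + 1) - w (z - 1) + poly p z / poly q z * (deriv w z / w z) = poly p0 z / poly q0 z"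
    and nz: "\<not> (\<forall>\<^sub>\<approx>z\<in>UNIV. w z = 0)"
    using eq unfolding solves_equation_def by blast+
  show ex: "\<exists>z. w z \<noteq> 0"
  proof (rule ccontr)
    assume "\<not> ?thesis"
    hence "\<forall>\<^sub>\<approx>z\<in>UNIV. w z = 0"
      by (intro always_eventually) auto
    with nz show False by blast
  qed
  then obtain b where b: "w b \<noteq> 0" by blast
  define D where "D z = (w (z + 1) - w (z - 1)) * poly (q * q0) z * w z + poly (p * q0) z * deriv w z
                          - poly (p0 * q) z * w z" for z
  have w2: "(\<lambda>z. w (z - 1)) holomorphic_on UNIV"
    using holomorphic_on_shift[OF w, of "-1"] by simp
  have hol: "D holomorphic_on UNIV"
    unfolding D_def by (intro holomorphic_intros w2 holomorphic_on_shift[OF w, of 1] w) auto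
  have "eventually (\<lambda>z. w z \<noteq> 0 \<and> z \<in> UNIV) (at 0)"
    by (rule non_zero_neighbour_alt[where \<beta> = b]) (use w b in auto)
  moreover have "\<forall>\<^sub>F z in at 0. w (z + 1) - w (z - 1) + poly p z / poly q z * (deriv w z / w z) = poly p0 z / poly q0 z"
    by (rule eventually_cosparse_imp_eventually_at[OF ev]) simp
  ultimately have "eventually (\<lambda>z. D z = 0) (at 0)"
    using eventually_poly_nonzero[OF q(1), of 0] eventually_poly_nonzero[OF q(2), of 0]
  proof eventually_elim
    case (elim z)
    define A where "A = w (z + 1) - w (z - 1)"
    have "A + poly p z / poly q z * (deriv w z / w z) = poly p0 z / poly q0 z"
      using elim by (simp add: A_def)
    hence "A * (poly q z * poly q0 z) * w z + poly p z * poly q0 z * deriv w z = poly p0 z * poly q z * w z"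
      using elim by (simp add: divide_simps) algebra
    thus ?case
      by (simp add: D_def A_def)
  qed
  from eventually_entire_zero_imp_zero[OF hol this, of z]
  show "(w (z + 1) - w (z - 1)) * poly (q * q0) z * w z + poly (p * q0) z * deriv w z = poly (p0 * q) z * w z"
    by (simp add: D_def)
qed

text \<open>At a zero of \<open>w\<close> of order \<open>m\<close>, the derivative of \<open>w\<close> vanishes only to order \<open>m - 1\<close>.\<close>
lemma zero_of_solution:
  assumes w: "w holomorphic_on UNIV" "w a \<noteq> 0" and E: "E holomorphic_on UNIV" and V: "V holomorphic_on UNIV"
    and eq: "\<And>z. E z * w z + V z * deriv w z = 0" and "w b = 0"
  shows "V b = 0"
proof (rule ccontr)
  assume Vb: "V b \<noteq> 0"
  have "\<exists>z\<in>UNIV. w z \<noteq> 0"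
    using w(2) by blast
  then obtain m h where h: "h holomorphic_on UNIV" "h b \<noteq> 0" "\<And>z. z \<in> UNIV \<Longrightarrow> w z = (z - b) ^ m * h z"
    using holomorphic_divide_out_zero[OF w(1) open_UNIV connected_UNIV UNIV_I[of b]] by metis
  have "m \<noteq> 0"
    using h(2) h(3)[of b] assms(6) by (intro notI) simp
  then obtain k where m: "m = Suc k"
    using not0_implies_Suc by blast
  \<comment> \<open>\<open>B\<close> is what remains of the equation after cancelling
    \<open>(z - b) ^ k\<close>; its value at \<open>b\<close> is \<open>m * V b * h b\<close>, which
    is nonzero.\<close>
  define B where "B z = (z - b) * E z * h z + V z * (of_nat m * h z + (z - b) * deriv h z)" for z
  have w_eq: "w = (\<lambda>z. (z - b) ^ m * h z)"
    using h(3) by auto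
  have dw: "deriv w z = of_nat m * (z - b) ^ k * h z + (z - b) ^ m * deriv h z" for z
  proof -
    have "((\<lambda>z. (z - b) ^ m) has_field_derivative of_nat m * (z - b) ^ k) (at z)"
      by (rule DERIV_cong[OF DERIV_power[OF DERIV_diff[OF DERIV_ident DERIV_const]]]) (simp add: m)
    from DERIV_mult[OF this holomorphic_derivI[OF h(1) open_UNIV UNIV_I]] show ?thesis
      unfolding w_eq by (intro DERIV_imp_deriv) (simp add: algebra_simps)
  qed
  have zero: "(z - b) ^ k * B z = 0" for z
    using eq[of z] unfolding dw B_def h(3)[OF UNIV_I] m by (simp add: algebra_simps)
  have "B holomorphic_on UNIV"
    unfolding B_def by (intro holomorphic_intros E V h(1)) auto
  moreover have "(\<lambda>z. (z - b) ^ k) holomorphic_on UNIV"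
    by (intro holomorphic_intros)
  moreover have "B b \<noteq> 0"
    using Vb h(2) \<open>m \<noteq> 0\<close> by (simp add: B_def)
  moreover have "((b + 1) - b) ^ k \<noteq> 0"
    by simp
  ultimately obtain z where "B z \<noteq> 0" "(z - b) ^ k \<noteq> 0"
    using entire_nonzero_common[of B "\<lambda>z. (z - b) ^ k" b "b + 1"] by blast
  with zero[of z] show False
    by simp
qed

text \<open>Dividing out the finitely many zeros leaves a zero-free entire function, which has a
  global logarithm.\<close>

lemma entire_finite_zeros_factorization:
  assumes "w holomorphic_on UNIV" "w a \<noteq> 0" "finite {z. w z = 0}"
  shows "\<exists>P g. P \<noteq> 0 \<and> g holomorphic_on UNIV \<and> (\<forall>z. w z = poly P z * exp (g z))"
proof -
  define Z where "Z = {z. w z = 0}"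
  have "finite Z" "\<exists>z\<in>UNIV. w z \<noteq> 0"
    using assms by (auto simp: Z_def)
  from holomorphic_divide_out_zeros[OF assms(1) open_UNIV connected_UNIV this(2,1) subset_UNIV]
  obtain m h where h: "h holomorphic_on UNIV" "\<forall>a\<in>Z. h a \<noteq> 0"
    "\<forall>z\<in>UNIV. w z = (\<Prod>a\<in>Z. (z - a) ^ m a) * h z"
    by blast
  have nz: "h z \<noteq> 0" for z
  proof
    assume hz: "h z = 0"
    hence "w z = 0"
      using bspec[OF h(3), of z] by simp
    hence "z \<in> Z"
      by (simp add: Z_def)
    with h(2) hz show False
      by blast
  qed
  obtain g where g: "g holomorphic_on UNIV" "\<And>z. z \<in> UNIV \<Longrightarrow> exp (g z) = h z"
    by (rule holomorphic_logarithm_exists[OF convex_UNIV open_UNIV h(1), of 0]) (use nz in auto)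
  have "w z = poly (\<Prod>a\<in>Z. [:-a, 1:] ^ m a) z * exp (g z)" for z
    using h(3) g(2) by (simp add: poly_prod)
  moreover have "(\<Prod>a\<in>Z. [:-a, 1:] ^ m a) \<noteq> 0"
    using \<open>finite Z\<close> by simp
  ultimately show ?thesis
    using g(1) by blast
qed

text \<open>The bound is asked only for arbitrarily large radii, because this is what the negation
  of \<open>transcendental\<close> provides. Cauchy's inequality at such radii kills the Taylor
  coefficients beyond \<open>n\<close>.\<close>

lemma entire_polynomial_growth_imp_poly:
  assumes "g holomorphic_on UNIV" "\<exists>\<^sub>F r in at_top. max_modulus g r < r ^ n"
  shows "\<exists>q. \<forall>z. g z = poly q z"
proof -
  have coeff_0: "(deriv ^^ k) g 0 = 0" if "k > n" for k
  proof (rule ccontr)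
    assume nz: "(deriv ^^ k) g 0 \<noteq> 0"
    define d where "d = norm ((deriv ^^ k) g 0)"
    have "d > 0"
      using nz by (simp add: d_def)
    hence "eventually (\<lambda>r. (fact k :: real) < d * r) at_top"
      by real_asymp
    hence "eventually (\<lambda>r. fact k < norm ((deriv ^^ k) g 0) * r) at_top"
      by (simp add: d_def)
    with eventually_ge_at_top[of 1]
    have "eventually (\<lambda>r. \<not> (max_modulus g r < r ^ n)) at_top"
    proof eventually_elim
      case (elim r)
      show ?case
      proof
        assume less: "max_modulus g r < r ^ n"
        have "norm ((deriv ^^ k) g 0) \<le> fact k * r ^ n / r ^ k"
        proof (rule Cauchy_inequality)
          show "norm (g x) \<le> r ^ n" if "norm (0 - x) = r" for x
            using norm_le_max_modulus[OF assms(1), of x r] less that by simp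
        qed (use assms(1) elim in \<open>auto intro: holomorphic_on_subset holomorphic_on_imp_continuous_on\<close>)
        hence "norm ((deriv ^^ k) g 0) * (r * r ^ n) \<le> fact k * r ^ n * (r * r ^ n) / r ^ k"
          using elim by (auto dest: mult_right_mono[of _ _ "r * r ^ n"])
        also have "\<dots> \<le> fact k * r ^ n"
        proof -
          have "r ^ Suc n \<le> r ^ k"
            using that elim by (intro power_increasing) auto
          hence "(r * r ^ n) / r ^ k \<le> 1"
            using elim by (simp add: divide_le_eq)
          hence "fact k * r ^ n * ((r * r ^ n) / r ^ k) \<le> fact k * r ^ n * 1"
            using elim by (intro mult_left_mono) auto
          thus ?thesis by simp
        qed
        finally have "(norm ((deriv ^^ k) g 0) * r) * r ^ n \<le> fact k * r ^ n"
          by (simp add: mult_ac)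
        thus False
          using elim by simp
      qed
    qed
    thus False
      using assms(2) by (simp add: frequently_def)
  qed
  define q where "q = (\<Sum>k\<le>n. monom ((deriv ^^ k) g 0 / fact k) k)"
  have "g z = poly q z" for z
  proof -
    have "((\<lambda>k. (deriv ^^ k) g 0 / fact k * (z - 0) ^ k) sums g z)"
      by (rule holomorphic_power_series[where r = "norm z + 1"])
         (use assms(1) in \<open>auto intro: holomorphic_on_subset\<close>)
    moreover have "((\<lambda>k. (deriv ^^ k) g 0 / fact k * (z - 0) ^ k) sums
        (\<Sum>k\<le>n. (deriv ^^ k) g 0 / fact k * (z - 0) ^ k))"
      by (rule sums_finite) (use coeff_0 in auto)
    ultimately show ?thesis
      by (simp add: q_def poly_sum poly_monom sums_unique2)
  qed
  thus ?thesis by blast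
qed

text \<open>Both factors are at most exponentials of powers of \<open>r\<close>, so the
  characteristic is at most \<open>r ^ (a + b + 1)\<close>.\<close>

lemma growth_order_poly_exp_poly:
  "growth_order (\<lambda>z. poly p z * exp (poly q z)) < \<infinity>"
proof -
  define w where "w z = poly p z * exp (poly q z)" for z
  have hol: "w holomorphic_on UNIV"
    unfolding w_def by (intro holomorphic_intros)
  obtain a where a: "eventually (\<lambda>r. \<forall>z. norm z \<le> r \<longrightarrow> norm (poly p z) \<le> r ^ a) at_top"
    using poly_growth by blast
  obtain b where b: "eventually (\<lambda>r. \<forall>z. norm z \<le> r \<longrightarrow> norm (poly q z) \<le> r ^ b) at_top"
    using poly_growth by blast
  have "growth_order w \<le> ereal (real (a + b + 1))"
    unfolding growth_order_def
  proof (rule Limsup_bounded)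
    show "\<forall>\<^sub>F r in at_top. ereal (ln (nevanlinna_char w r) / ln r) \<le> ereal (real (a + b + 1))"
      using a b eventually_ge_at_top[of 2]
    proof eventually_elim
      case (elim r)
      have "nevanlinna_char w r \<le> r ^ a + r ^ b"
      proof (rule nevanlinna_char_le[OF hol])
        fix z :: complex assume z: "norm z \<le> r"
        have "norm (w z) = norm (poly p z) * exp (Re (poly q z))"
          by (simp add: w_def norm_mult)
        also have "\<dots> \<le> exp (r ^ a) * exp (r ^ b)"
        proof (rule mult_mono)
          show "norm (poly p z) \<le> exp (r ^ a)"
            using elim(1) z exp_ge_add_one_self[of "r ^ a"] by (smt (verit))
          show "exp (Re (poly q z)) \<le> exp (r ^ b)"
            using elim(2) z complex_Re_le_cmod[of "poly q z"] by (auto intro: order_trans)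
        qed auto
        finally show "norm (w z) \<le> exp (r ^ a + r ^ b)"
          by (simp add: exp_add)
      qed (use elim in auto)
      also have "\<dots> \<le> r ^ (a + b) + r ^ (a + b)"
        using elim by (intro add_mono power_increasing) auto
      also have "\<dots> = 2 * r ^ (a + b)"
        by simp
      also have "\<dots> \<le> r * r ^ (a + b)"
        using elim by (intro mult_right_mono) auto
      finally have le: "nevanlinna_char w r \<le> r ^ (a + b + 1)"
        by simp
      have "ln (nevanlinna_char w r) \<le> real (a + b + 1) * ln r"
      \<comment> \<open>A vanishing characteristic is treated apart: there \<open>ln 0 = 0\<close>
        is a default value.\<close>
      proof (cases "nevanlinna_char w r = 0")
        case True
        thus ?thesis
          using elim by simp
      next
        case False
        hence "nevanlinna_char w r > 0"
          using nevanlinna_char_nonneg[OF hol, of r] by simp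
        hence "ln (nevanlinna_char w r) \<le> ln (r ^ (a + b + 1))"
          using le by (intro ln_mono) auto
        thus ?thesis
          using elim ln_realpow[of r "a + b + 1"] by simp
      qed
      thus ?case
        using elim by (simp add: divide_le_eq)
    qed
  qed
  thus ?thesis
    unfolding w_def[abs_def] using le_less_trans by fastforce
qed

context transcendental_entire
begin

text \<open>The bound of \<open>V\<close> from below on large circles and the maximum principle give
  the derivative polynomial growth, and then \<open>g\<close> too. This will show that the
  right-hand side of the reduced equation is not identically zero.\<close>

lemma deriv_not_rational:
  assumes "V \<noteq> 0" "\<And>z. poly V z * deriv g z = poly U z"
  shows False
proof -
  obtain d R where d: "d > 0" "\<And>z. norm z \<ge> R \<Longrightarrow> norm (poly V z) \<ge> d"
    using poly_bounded_below_at_infinity[OF assms(1)] by blast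
  obtain m where m: "eventually (\<lambda>r. \<forall>z. norm z \<le> r \<longrightarrow> norm (poly U z) \<le> r ^ m) at_top"
    using poly_growth by blast
  have hol': "deriv g holomorphic_on UNIV"
    by (intro holomorphic_intros entire) auto
  have "eventually (\<lambda>r. \<mu> r \<le> norm (g 0) + r ^ (m + 2)) at_top"
    using m eventually_ge_at_top[of R] eventually_ge_at_top[of "1 / d"] eventually_gt_at_top[of 0]
  proof eventually_elim
    case (elim r)
    have "norm (deriv g z) \<le> r ^ (m + 1)" if "norm z \<le> r" for z
    proof (rule norm_le_of_sphere[OF hol' _ that])
      fix z :: complex assume z: "norm z = r"
      have "d * norm (deriv g z) \<le> norm (poly V z) * norm (deriv g z)"
        using d(2)[of z] z elim by (intro mult_right_mono) auto
      also have "\<dots> = norm (poly U z)"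
        by (simp flip: norm_mult assms(2))
      also have "\<dots> \<le> 1 * r ^ m"
        using elim z by simp
      also have "\<dots> \<le> (d * r) * r ^ m"
        using elim d(1) by (intro mult_right_mono) (auto simp: field_simps)
      finally show "norm (deriv g z) \<le> r ^ (m + 1)"
        using d(1) by (simp add: mult.assoc)
    qed
    hence bound: "norm (g z - g 0) \<le> r ^ (m + 1) * norm (z - 0)" if "norm z \<le> r" for z
      using that elim holomorphic_derivI[OF entire open_UNIV UNIV_I]
      by (intro field_differentiable_bound[of "cball 0 r" g "deriv g"])
         (auto intro: has_field_derivative_at_within)
    show ?case
    proof (rule max_modulus_le)
      fix z :: complex assume z: "norm z \<le> r"
      have "r ^ (m + 1) * norm (z - 0) \<le> r ^ (m + 1) * r"
        using z elim by (intro mult_left_mono) auto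
      thus "norm (g z) \<le> norm (g 0) + r ^ (m + 2)"
        using bound[OF z] norm_triangle_ineq2[of "g z" "g 0"] by (simp add: mult.commute)
    qed (use elim in auto)
  qed
  moreover have "eventually (\<lambda>r. norm (g 0) + r ^ (m + 2) < r ^ (m + 3)) at_top"
    using eventually_gt_at_top[of "norm (g 0) + 1"]
  proof eventually_elim
    case (elim r)
    have "r \<ge> 1"
      using elim norm_ge_zero[of "g 0"] by linarith
    have "norm (g 0) * 1 \<le> norm (g 0) * r ^ (m + 2)"
      using \<open>r \<ge> 1\<close> by (intro mult_left_mono one_le_power) auto
    hence "norm (g 0) + r ^ (m + 2) \<le> (norm (g 0) + 1) * r ^ (m + 2)"
      by (simp add: algebra_simps)
    also have "\<dots> < r * r ^ (m + 2)"
      using elim \<open>r \<ge> 1\<close> by (intro mult_strict_right_mono) auto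
    finally show ?case
      by (simp add: numeral_3_eq_3 del: power_Suc flip: power_Suc)
  qed
  ultimately have "eventually (\<lambda>_. False) (at_top :: real filter)"
    using transcendental[of "m + 3"] by eventually_elim linarith
  thus False
    by simp
qed

text \<open>The inequality says that the logarithm of the maximum modulus at \<open>K r\<close> exceeds the
  exponential of the one at \<open>r\<close>. Finitely many such steps beat any fixed number of iterated
  logarithms.\<close>
lemma log_bound_contradicts_iterated_log:
  assumes "C > 0" "K \<ge> 1" "\<forall>\<^sub>F r in at_top. \<mu> r \<le> C * ln (\<mu> (K * r))"
    and T: "\<forall>\<^sub>F r in at_top. \<mu> r \<le> 8 * T (2 * r) + B"
    and iter: "\<forall>\<^sub>F r in at_top. (ln ^^ i) (T r) \<le> c * ln r"
  shows False
proof -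
  \<comment> \<open>Halving the logarithm makes \<open>\<mu> r\<close> the square of
    \<open>exp (\<tau> r)\<close>; one of the two factors absorbs the constant \<open>2 * C\<close>,
    so one step is a clean exponential.\<close>
  define \<tau> where "\<tau> r = ln (\<mu> r) / 2" for r
  have \<mu>_top: "filterlim \<mu> at_top at_top"
    by (rule filterlim_at_top_mono[OF filterlim_ident]) (use transcendental[of 1] in simp)
  have "eventually (\<lambda>x. 2 * C \<le> exp (ln x / 2) \<and> x > 0 \<and> 4 * ln x + B \<le> x) at_top"
    by (intro eventually_conj; real_asymp)
  hence \<mu>_ev: "eventually (\<lambda>r. 2 * C \<le> exp (\<tau> r) \<and> \<mu> r > 0 \<and> 8 * \<tau> r + B \<le> \<mu> r) at_top"
    using \<mu>_top unfolding filterlim_iff \<tau>_def by fastforce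
  have "eventually (\<lambda>r. exp (\<tau> r) \<le> \<tau> (K * r)) at_top"
    using \<mu>_ev assms(3)
  proof eventually_elim
    case (elim r)
    have "2 * C * exp (\<tau> r) \<le> exp (\<tau> r) * exp (\<tau> r)"
      using elim by (intro mult_right_mono) auto
    also have "\<dots> = \<mu> r"
      using elim by (simp add: \<tau>_def flip: exp_add)
    also have "\<dots> \<le> 2 * C * \<tau> (K * r)"
      using elim by (simp add: \<tau>_def)
    finally show ?case
      using assms(1) by simp
  qed
  then obtain r1 where r1: "\<And>r. r \<ge> r1 \<Longrightarrow> exp (\<tau> r) \<le> \<tau> (K * r)"
    unfolding eventually_at_top_linorder by blast
  have tower: "(exp ^^ n) (\<tau> r) \<le> \<tau> (K ^ n * r)" if "r \<ge> r1" "r \<ge> 0" for n r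
  proof (induction n)
    case (Suc n)
    have "1 * r \<le> K ^ n * r"
      using assms(2) that by (intro mult_right_mono one_le_power) auto
    hence "exp (\<tau> (K ^ n * r)) \<le> \<tau> (K * (K ^ n * r))"
      using that by (intro r1) simp
    moreover have "exp ((exp ^^ n) (\<tau> r)) \<le> exp (\<tau> (K ^ n * r))"
      using Suc.IH by simp
    ultimately have "exp ((exp ^^ n) (\<tau> r)) \<le> \<tau> (K * (K ^ n * r))"
      by linarith
    thus ?case
      by (simp add: mult.assoc)
  qed simp
  \<comment> \<open>One step more than there are logarithms: after removing \<open>i\<close> of them
    \<open>exp (\<tau> r)\<close> is left, which still exceeds any multiple of
    \<open>ln r\<close>.\<close>
  define A where "A = K ^ (i + 1)"
  have A: "A > 0" "2 * A > 0"
    using assms(2) by (simp_all add: A_def)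
  have "eventually (\<lambda>r. c * ln (2 * A * r) < r) at_top"
    using A by real_asymp
  moreover have "eventually (\<lambda>r. (ln ^^ i) (T (2 * A * r)) \<le> c * ln (2 * A * r)) at_top"
    using eventually_scaled[OF iter A(2)] .
  moreover have "eventually (\<lambda>r. \<mu> (A * r) \<le> 8 * T (2 * A * r) + B) at_top"
    using eventually_scaled[OF T A(1)] by (simp add: mult.assoc)
  moreover have "eventually (\<lambda>r. 8 * \<tau> (A * r) + B \<le> \<mu> (A * r)) at_top"
    using eventually_scaled[OF \<mu>_ev A(1)] by eventually_elim simp
  ultimately have "eventually (\<lambda>_. False) (at_top :: real filter)"
    using transcendental[of 2] \<mu>_ev eventually_ge_at_top[of r1] eventually_ge_at_top[of 0]
  proof eventually_elim
    case (elim r)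
    have "(exp ^^ i) (exp (\<tau> r)) \<le> \<tau> (A * r)"
      using tower[of r "i + 1"] elim by (simp add: A_def funpow_swap1)
    also have "\<dots> \<le> T (2 * A * r)"
      using elim by linarith
    finally have "exp (\<tau> r) \<le> (ln ^^ i) (T (2 * A * r))"
      by (rule iterated_ln_ge)
    \<comment> \<open>\<open>exp (\<tau> r)\<close> is the square root of \<open>\<mu> r\<close>,
      which is at least \<open>r^2\<close>.\<close>
    moreover have "r \<le> exp (\<tau> r)"
    proof (rule power2_le_imp_le)
      show "r\<^sup>2 \<le> (exp (\<tau> r))\<^sup>2"
        using elim by (simp add: \<tau>_def power2_eq_square flip: exp_add)
    qed simp
    ultimately show False
      using elim by linarith
  qed
  thus False by simp
qed

end

theorem theorem1p4:
  fixes a a0 :: "complex \<Rightarrow> complex"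
  assumes "rational_function a" and "rational_function a0"
    and "\<exists>z. a z \<noteq> 0"
  shows "\<not> (\<exists>w. w holomorphic_on UNIV \<and> solves_equation a a0 w \<and>
               growth_order w = \<infinity> \<and> (\<exists>i\<ge>2. iterated_order i w < \<infinity>))"
proof
  assume "\<exists>w. w holomorphic_on UNIV \<and> solves_equation a a0 w \<and>
               growth_order w = \<infinity> \<and> (\<exists>i\<ge>2. iterated_order i w < \<infinity>)"
  then obtain w i where w: "w holomorphic_on UNIV" "solves_equation a a0 w" "growth_order w = \<infinity>"
    "iterated_order i w < \<infinity>"
    by blast
  obtain p q where pq: "q \<noteq> 0" "a = (\<lambda>z. poly p z / poly q z)"
    using assms(1) unfolding rational_function_def by blast
  obtain p0 q0 where pq0: "q0 \<noteq> 0" "a0 = (\<lambda>z. poly p0 z / poly q0 z)"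
    using assms(2) unfolding rational_function_def by blast
  have "p \<noteq> 0"
    using assms(3) pq by auto
  note eq = poly_differential_equation(1)[OF w(1) pq(1) pq0(1) w(2)[unfolded pq(2) pq0(2)]]
  obtain b where b: "w b \<noteq> 0"
    using poly_differential_equation(2)[OF w(1) pq(1) pq0(1) w(2)[unfolded pq(2) pq0(2)]] by blast
  \<comment> \<open>After clearing denominators \<open>V\<close> is the coefficient of
    \<open>w'\<close> and \<open>E\<close> below that of \<open>w\<close>, so every zero of
    \<open>w\<close> is a root of \<open>V\<close>.\<close>
  define V where "V = p * q0"
  have "V \<noteq> 0"
    using \<open>p \<noteq> 0\<close> pq0(1) by (simp add: V_def)
  define E where "E z = (w (z + 1) - w (z - 1)) * poly (q * q0) z - poly (p0 * q) z" for z
  have w_shift: "(\<lambda>z. w (z - 1)) holomorphic_on UNIV" "(\<lambda>z. w (z + 1)) holomorphic_on UNIV"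
    using holomorphic_on_shift[OF w(1), of "-1" UNIV] holomorphic_on_shift[OF w(1), of 1 UNIV] by simp_all
  have "E holomorphic_on UNIV"
    unfolding E_def by (intro holomorphic_intros w_shift)
  hence "poly V z = 0" if "w z = 0" for z
  proof (rule zero_of_solution[OF w(1) b _ _ _ that])
    show "E z * w z + poly V z * deriv w z = 0" for z
      using eq[of z] by (simp add: E_def V_def algebra_simps)
  qed (intro holomorphic_intros)
  hence "{z. w z = 0} \<subseteq> {z. poly V z = 0}"
    by blast
  hence "finite {z. w z = 0}"
    using poly_roots_finite[OF \<open>V \<noteq> 0\<close>] finite_subset by blast
  then obtain P g where P: "P \<noteq> 0" and g: "g holomorphic_on UNIV"
    and w_eq: "\<And>z. w z = poly P z * exp (g z)"
    using entire_finite_zeros_factorization[OF w(1) b] by blast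
  have w_fun: "w = (\<lambda>z. poly P z * exp (g z))"
    using w_eq by auto
  \<comment> \<open>Otherwise \<open>g\<close> would be a polynomial and \<open>w\<close> of finite
    order.\<close>
  have "eventually (\<lambda>r. r ^ n \<le> max_modulus g r) at_top" for n
  proof (rule ccontr)
    assume "\<not> ?thesis"
    hence "\<exists>\<^sub>F r in at_top. max_modulus g r < r ^ n"
      by (simp add: not_eventually not_le)
    then obtain u where u: "\<And>z. g z = poly u z"
      using entire_polynomial_growth_imp_poly[OF g] by blast
    have "growth_order w < \<infinity>"
      unfolding w_fun u by (rule growth_order_poly_exp_poly)
    with w(3) show False by simp
  qed
  then interpret transcendental_entire g
    using g by unfold_locales
  \<comment> \<open>Inserting \<open>w = P * exp g\<close>, multiplying by \<open>q * q0 * P\<close>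
    and cancelling gives \<open>D * (w(z+1) - w(z-1)) = U - W * g'\<close>. The right side is
    \<open>S\<close>, the left side \<open>X - Y\<close>.\<close>
  define D where "D = q * q0 * P"
  define U where "U = p0 * q * P - p * q0 * pderiv P"
  define W where "W = p * q0 * P"
  define P1 where "P1 = D * pcompose P [:1, 1:]"
  define P2 where "P2 = D * pcompose P [:-1, 1:]"
  have nz: "D \<noteq> 0" "W \<noteq> 0" "P1 \<noteq> 0" "P2 \<noteq> 0"
    using pq(1) pq0(1) P \<open>p \<noteq> 0\<close> by (auto simp: D_def W_def P1_def P2_def pcompose_eq_0)
  define g1 where "g1 z = g (z + 1)" for z
  define g2 where "g2 z = g (z - 1)" for z
  have tame_g12: "tame g1" "tame g2"
    using tame_shift[OF tame_self, of 1] tame_shift[OF tame_self, of "-1"]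
    by (simp_all add: g1_def[abs_def] g2_def[abs_def])
  define X where "X z = poly P1 z * exp (g1 z)" for z
  define Y where "Y z = poly P2 z * exp (g2 z)" for z
  define S where "S z = poly U z - poly W z * deriv g z" for z
  \<comment> \<open>\<alpha> and \<beta> are the logarithmic derivatives of \<open>X\<close> and
    \<open>Y\<close>, both multiplied by \<open>P1 * P2\<close> to clear their denominators at
    once.\<close>
  define \<alpha> where "\<alpha> z = poly (pderiv P1 * P2) z + poly (P1 * P2) z * deriv g1 z" for z
  define \<beta> where "\<beta> z = poly (pderiv P2 * P1) z + poly (P1 * P2) z * deriv g2 z" for z
  have hol12: "g1 holomorphic_on UNIV" "g2 holomorphic_on UNIV"
    using tame_g12 by (simp_all add: tame_entire)
  have "tame S" "tame \<alpha>" "tame \<beta>"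
    unfolding S_def \<alpha>_def \<beta>_def
    by (intro tame_add tame_diff tame_mult tame_poly tame_deriv tame_self tame_g12)+
  have deriv_poly_exp: "deriv (\<lambda>z. poly Q z * exp (f z)) z = (poly (pderiv Q) z + poly Q z * deriv f z) * exp (f z)"
    if "f holomorphic_on UNIV" for Q f z
    by (rule DERIV_imp_deriv)
       (auto intro!: derivative_eq_intros holomorphic_derivI[OF that] simp: algebra_simps)
  have S_eq: "S z = X z - Y z" for z
  proof -
    have "(w (z + 1) - w (z - 1)) * poly (q * q0) z * (poly P z * exp (g z)) +
        poly (p * q0) z * ((poly (pderiv P) z + poly P z * deriv g z) * exp (g z)) =
        poly (p0 * q) z * (poly P z * exp (g z))"
      using eq[of z] deriv_poly_exp[OF g, of P z] w_eq[of z] unfolding w_fun[symmetric] by simp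
    hence "((w (z + 1) - w (z - 1)) * poly D z) * exp (g z) = S z * exp (g z)"
      by (simp add: D_def S_def U_def W_def algebra_simps)
    hence "S z = (w (z + 1) - w (z - 1)) * poly D z"
      by simp
    also have "\<dots> = X z - Y z"
      by (simp add: w_eq X_def Y_def P1_def P2_def g1_def g2_def poly_pcompose algebra_simps)
    finally show ?thesis .
  qed
  have "\<exists>c. S c \<noteq> 0"
  proof (rule ccontr)
    assume "\<not> ?thesis"
    hence "poly W z * deriv g z = poly U z" for z
      by (auto simp: S_def)
    with deriv_not_rational[OF nz(2)] show False by blast
  qed
  then obtain c where c: "S c \<noteq> 0" by blast
  obtain e where e: "poly (P1 * P2) e \<noteq> 0"
    using nz poly_all_0_iff_0[of "P1 * P2"] by auto
  have "tame X"
  proof (rule tame_of_tame_difference[where p = "poly (P1 * P2)" and Y = Y, OF \<open>tame S\<close> tame_poly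
        \<open>tame \<alpha>\<close> \<open>tame \<beta>\<close> _ _ S_eq _ _ e c])
    show "poly (P1 * P2) z * deriv X z = \<alpha> z * X z" for z
      unfolding X_def[abs_def] deriv_poly_exp[OF hol12(1)] \<alpha>_def by (simp add: algebra_simps)
    show "poly (P1 * P2) z * deriv Y z = \<beta> z * Y z" for z
      unfolding Y_def[abs_def] deriv_poly_exp[OF hol12(2)] \<beta>_def by (simp add: algebra_simps)
    show "X holomorphic_on UNIV" "Y holomorphic_on UNIV"
      unfolding X_def Y_def by (intro holomorphic_intros hol12)+
  qed
  obtain d where d: "poly P1 d \<noteq> 0"
    using nz(3) poly_all_0_iff_0 by blast
  \<comment> \<open>The quotient of \<open>X\<close> by the polynomial \<open>P1\<close> is entire,
    hence tame; shifting back by 1 then gives \<open>exp g\<close>.\<close>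
  have "tame (\<lambda>z. exp (g1 z))"
    by (rule tame_quotient[where F = X and G = "poly P1" and c = d, OF \<open>tame X\<close> tame_poly _ _ d])
       (auto intro!: holomorphic_intros hol12 simp: X_def)
  from tame_shift[OF this, of "-1"] have "tame (\<lambda>z. exp (g z))"
    by (simp add: g1_def)
  then obtain C K where CK: "C > 0" "K \<ge> 1" "\<forall>\<^sub>F r in at_top. \<mu> r \<le> C * ln (\<mu> (K * r))"
    by (rule tame_exp_imp_log_bound)
  obtain B where B: "\<forall>\<^sub>F r in at_top. \<mu> r \<le> 8 * nevanlinna_char w (2 * r) + B"
    using max_modulus_le_nevanlinna_char[OF g P] unfolding w_fun by blast
  obtain k where k: "iterated_order i w < ereal k"
    using w(4) less_PInf_Ex_of_nat by auto
  have "\<forall>\<^sub>F r in at_top. ereal ((ln ^^ i) (nevanlinna_char w r) / ln r) < ereal k"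
    using k unfolding iterated_order_def by (rule Limsup_lessD)
  hence "\<forall>\<^sub>F r in at_top. (ln ^^ i) (nevanlinna_char w r) \<le> k * ln r"
    using eventually_gt_at_top[of 1]
    by eventually_elim (simp add: divide_less_eq)
  from log_bound_contradicts_iterated_log[OF CK B this] show False .
qed

end
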